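(* Let $\mu$ be a self-similar measure on $\mathbb{R}^d$, $K$ its support, and let $(B_n)_{n\in\mathbb{N}}$ be a weakly redundant sequence of balls of $\mathbb{R}^d$ verifying $|B_n|\to0$. Let $(U_n)_{n\in\mathbb{N}}$ be a sequence of open sets satisfying $U_n\subset B_n$ for every $n$. For any $0\le s<\dim(\mu)$ such that, for all large enough $n\in\mathbb{N}$, $\mathcal{H}^{\mu,s}_\infty(U_n)\le\mu(B_n)$, one has $$\dim_H\Big(\limsup_{n\to+\infty}U_n\cap K\Big)\le s.$$
   Context: Balls are closed balls $B(x,r)$ ($r>0$) of $(\mathbb{R}^d,\|\cdot\|_\infty)$; $|B|$ is the diameter of $B$. $\limsup_{n\to+\infty}U_n=\bigcap_{g}\bigcup_{n\ge g}U_n$. $\dim_H$ of a set is its Hausdorff dimension. Self-similar measure: given a family $S=\{f_i\}_{i=1}^m$ of $m\ge2$ contracting similarities of $\mathbb{R}^d$ and $(p_i)_{i=1}^m\in(0,1)^m$ with $\sum_ip_i=1$, the associated self-similar measure is the unique Borel probability measure $\mu$ with $\mu=\sum_{i=1}^mp_i\,\mu\circ f_i^{-1}$. Its support is the attractor $K$, the unique non-empty compact set with $K=\bigcup_if_i(K)$. Every self-similar measure is exact dimensional: there is a number, denoted $\dim(\mu)$, with $\lim_{r\to0^+}\frac{\log\mu(B(x,r))}{\log r}=\dim(\mu)$ for $\mu$-almost every $x$. For $s\ge0$ and a set $E$, $\mathcal{H}^s_\infty(E)=\inf\{\sum_{n}|B_n|^s: (B_n)\text{ closed balls},\ E\subset\bigcup_nB_n\}$.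 For a Borel set $A$, the $\mu$-essential Hausdorff content is $\mathcal{H}^{\mu,s}_\infty(A)=\inf\{\mathcal{H}^s_\infty(E): E\subset A\text{ Borel},\ \mu(E)=\mu(A)\}$. A family of balls $\mathcal{B}=(B_n=B(x_n,r_n))_{n\in\mathbb{N}}$ is weakly redundant if, with $\mathcal{T}_k(\mathcal{B})$ the (indexed) family of those $B_n$ with $2^{-k-1}<r_n\le2^{-k}$, for every $k\in\mathbb{N}$ there exist an integer $J_k\ge1$ and a partition of $\mathcal{T}_k(\mathcal{B})$ into $J_k$ (possibly empty) subfamilies $\mathcal{T}_{k,1}(\mathcal{B}),\dots,\mathcal{T}_{k,J_k}(\mathcal{B})$ such that any two different members of the same $\mathcal{T}_{k,j}(\mathcal{B})$ are disjoint, and $\lim_{k\to+\infty}\frac{\log_2(J_k)}{k}=0$. (Balls with different indices count as different members.) *)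

theory Defs
  imports "HOL-Analysis.Analysis" "HOL-Probability.Probability"
begin

subsection \<open>Balls and diameters for the sup norm\<close>

text \<open>
  The type \<open>real ^ 'd\<close> carries the Euclidean metric in the library, so balls and diameters for the
  sup norm (\<^const>\<open>infnorm\<close>) are introduced separately. Both norms have the same open, closed,
  bounded and Borel sets.
\<close>

definition sup_cball :: "real ^ 'd \<Rightarrow> real \<Rightarrow> (real ^ 'd) set" where
  "sup_cball x r = {y. infnorm (y - x) \<le> r}"

text \<open>As for the library's \<^const>\<open>diameter\<close>, the value is only meaningful for bounded sets.\<close>

definition sup_diameter :: "(real ^ 'd) set \<Rightarrow> real" where
  "sup_diameter S = (if S = {} then 0 else SUP (x, y) \<in> S \<times> S. infnorm (x - y))"

text \<open>
  \<open>|S|\<^sup>s\<close> with the conventions \<open>|S|\<^sup>0 = 1\<close> for nonempty \<open>S\<close> (whereas \<open>0 powr 0 = 0\<close>) and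
  \<open>|{}|\<^sup>s = 0\<close>.
\<close>

definition diameter_pow :: "real \<Rightarrow> (real ^ 'd) set \<Rightarrow> ennreal" where
  "diameter_pow s S =
     (if S = {} then 0 else if s = 0 then 1 else ennreal (sup_diameter S powr s))"

subsection \<open>Hausdorff content, measure and dimension\<close>

text \<open>
  Covers are at most countable families: the index set \<open>I\<close> is an arbitrary set of natural numbers,
  so finite covers are allowed (this matters only for \<open>s = 0\<close>).
\<close>

definition hausdorff_content :: "real \<Rightarrow> (real ^ 'd) set \<Rightarrow> ennreal" where
  "hausdorff_content s E =
     Inf {(\<Sum>\<^sub>\<infinity>i\<in>I. diameter_pow s (sup_cball (x i) (r i))) | (I :: nat set) x r.
            (\<forall>i\<in>I. 0 < r i) \<and> E \<subseteq> (\<Union>i\<in>I. sup_cball (x i) (r i))}"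

definition essential_content ::
    "(real ^ 'd) measure \<Rightarrow> real \<Rightarrow> (real ^ 'd) set \<Rightarrow> ennreal" where
  "essential_content \<mu> s A =
     Inf {hausdorff_content s E | E. E \<in> sets borel \<and> E \<subseteq> A \<and> emeasure \<mu> E = emeasure \<mu> A}"

definition hausdorff_premeasure :: "real \<Rightarrow> real \<Rightarrow> (real ^ 'd) set \<Rightarrow> ennreal" where
  "hausdorff_premeasure \<delta> s E =
     Inf {(\<Sum>\<^sub>\<infinity>i\<in>I. diameter_pow s (V i)) | (I :: nat set) V.
            (\<forall>i\<in>I. bounded (V i) \<and> sup_diameter (V i) \<le> \<delta>) \<and> E \<subseteq> (\<Union>i\<in>I. V i)}"

definition hausdorff_measure :: "real \<Rightarrow> (real ^ 'd) set \<Rightarrow> ennreal" where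
  "hausdorff_measure s E = (SUP \<delta>\<in>{0<..}. hausdorff_premeasure \<delta> s E)"

definition hausdorff_dim :: "(real ^ 'd) set \<Rightarrow> ennreal" where
  "hausdorff_dim E = Inf {ennreal s | s. 0 \<le> s \<and> hausdorff_measure s E = 0}"

subsection \<open>Self-similar measures\<close>

definition contracting_similarity :: "(real ^ 'd \<Rightarrow> real ^ 'd) \<Rightarrow> bool" where
  "contracting_similarity f \<longleftrightarrow> (\<exists>c. 0 < c \<and> c < 1 \<and> (\<forall>x y. dist (f x) (f y) = c * dist x y))"

definition self_similar_measure ::
    "nat \<Rightarrow> (nat \<Rightarrow> real ^ 'd \<Rightarrow> real ^ 'd) \<Rightarrow> (nat \<Rightarrow> real) \<Rightarrow> (real ^ 'd) measure \<Rightarrow> bool" where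
  "self_similar_measure m f p \<mu> \<longleftrightarrow>
     2 \<le> m \<and>
     (\<forall>i\<in>{1..m}. contracting_similarity (f i)) \<and>
     (\<forall>i\<in>{1..m}. 0 < p i \<and> p i < 1) \<and> (\<Sum>i=1..m. p i) = 1 \<and>
     sets \<mu> = sets borel \<and> prob_space \<mu> \<and>
     (\<forall>A\<in>sets borel. emeasure \<mu> A = (\<Sum>i=1..m. ennreal (p i) * emeasure (distr \<mu> borel (f i)) A))"

definition measure_support :: "(real ^ 'd) measure \<Rightarrow> (real ^ 'd) set" where
  "measure_support \<mu> = {x. \<forall>V. open V \<longrightarrow> x \<in> V \<longrightarrow> 0 < emeasure \<mu> V}"

text \<open>
  \<open>\<mu>\<close> is exact dimensional with \<open>dim(\<mu>) = D\<close>. For a probability measure there is at most one such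
  \<open>D\<close>, and a self-similar measure has one by the theorem of Feng and Hu.
\<close>

definition has_exact_dimension :: "(real ^ 'd) measure \<Rightarrow> real \<Rightarrow> bool" where
  "has_exact_dimension \<mu> D \<longleftrightarrow>
     (AE x in \<mu>. ((\<lambda>r. ln (measure \<mu> (sup_cball x r)) / ln r) \<longlongrightarrow> D) (at_right 0))"

subsection \<open>Weakly redundant families\<close>

text \<open>
  Subfamilies are sets of indices, so equal balls with different indices count as different
  members.
\<close>

definition dyadic_family :: "(nat \<Rightarrow> real) \<Rightarrow> nat \<Rightarrow> nat set" where
  "dyadic_family r k = {n. (1/2) ^ (k + 1) < r n \<and> r n \<le> (1/2) ^ k}"

definition weakly_redundant :: "(nat \<Rightarrow> real ^ 'd) \<Rightarrow> (nat \<Rightarrow> real) \<Rightarrow> bool" where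
  "weakly_redundant x r \<longleftrightarrow>
     (\<exists>J :: nat \<Rightarrow> nat.
        (\<forall>k. 1 \<le> J k \<and>
           (\<exists>P :: nat \<Rightarrow> nat set.
              (\<Union>j\<in>{1..J k}. P j) = dyadic_family r k \<and>
              disjoint_family_on P {1..J k} \<and>
              (\<forall>j\<in>{1..J k}. disjoint_family_on (\<lambda>n. sup_cball (x n) (r n)) (P j)))) \<and>
        (\<lambda>k. log 2 (real (J k)) / real k) \<longlonglongrightarrow> 0)"

end

theory Submission
  imports Defs
begin

text \<open>
  The key is a comparison of contents, \<open>hausdorff_content_le_essential_content\<close>: for a self-similar
  measure \<open>\<mu>\<close> of dimension \<open>D\<close> and \<open>0 \<le> s < D\<close> there is a constant \<open>C\<close> such that every open set
  \<open>\<Omega>\<close> satisfies \<open>H\<^sup>s(\<Omega> \<inter> K) \<le> C H\<^sup>\<mu>\<^sup>,\<^sup>s(\<Omega>)\<close>, where \<open>H\<^sup>s\<close> and \<open>H\<^sup>\<mu>\<^sup>,\<^sup>s\<close> are the Hausdorff content and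
  the essential content, and \<open>K\<close> is the support.

  Two facts yield this comparison. First, a Borel set of full \<open>\<mu>\<close>-measure has \<open>s\<close>-content bounded
  below by a positive constant, because \<open>\<mu>(B(y,\<rho>)) \<le> \<rho>\<^sup>s\<close> for small \<open>\<rho>\<close> at almost every \<open>y\<close>
  (\<open>full_measure_cover_lower_bound\<close>). Secondly, every point of the support has similar copies of \<open>\<mu>\<close>
  nearby, at arbitrarily small scales, which are absolutely continuous with respect to \<open>\<mu>\<close>
  (\<open>self_similar_small_copies\<close>). If \<open>E\<close> has full measure in \<open>\<Omega>\<close>, the first fact applies to \<open>E\<close> within each
  copy inside \<open>\<Omega>\<close>. A Vitali selection of disjoint copies then turns a cover of \<open>E\<close> into
  a cover of \<open>\<Omega> \<inter> K\<close> of comparable cost (\<open>hausdorff_content_le_cover\<close>). No separation condition on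
  the iterated function system is needed.

  The theorem then follows by a Borel-Cantelli argument. The hypothesis gives
  \<open>H\<^sup>s(U\<^sub>n \<inter> K) \<le> C \<mu>(B\<^sub>n)\<close>. For \<open>t = s + \<theta>\<close> with \<open>\<theta> > 0\<close>, intersecting the covering sets with
  \<open>B\<^sub>n\<close> bounds the \<open>t\<close>-premeasure of \<open>U\<^sub>n \<inter> K\<close> by a constant times \<open>r\<^sub>n\<^sup>\<theta> \<mu>(B\<^sub>n)\<close>
  (\<open>hausdorff_premeasure_le_content\<close>). The measures of the balls of scale \<open>2\<^sup>-\<^sup>k\<close> add up to at most
  \<open>J\<^sub>k\<close>, which grows subexponentially in \<open>k\<close>, so the sum over all \<open>n\<close> is dominated by a
  geometric series.
\<close>

section \<open>Sums of extended nonnegative reals\<close>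

lemma ennreal_summable_on [simp]: "f summable_on A" for f :: "'a \<Rightarrow> ennreal"
  by (rule nonneg_summable_on_complete) simp

lemma infsum_ennreal_le:
  fixes f :: "'a \<Rightarrow> ennreal"
  assumes "\<And>F. finite F \<Longrightarrow> F \<subseteq> A \<Longrightarrow> sum f F \<le> B"
  shows "infsum f A \<le> B"
  by (subst nonneg_infsum_complete) (auto intro!: SUP_least assms)

lemma sum_le_infsum_ennreal:
  fixes f :: "'a \<Rightarrow> ennreal"
  assumes "finite F" "F \<subseteq> A"
  shows "sum f F \<le> infsum f A"
  by (subst nonneg_infsum_complete) (auto intro!: SUP_upper assms)

lemma infsum_ennreal_mono:
  fixes f g :: "'a \<Rightarrow> ennreal"
  assumes "\<And>i. i \<in> A \<Longrightarrow> f i \<le> g i"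
  shows "infsum f A \<le> infsum g A"
  by (rule infsum_mono) (auto intro: assms)

lemma infsum_ennreal_cmult_le:
  fixes f g :: "'a \<Rightarrow> ennreal"
  assumes "\<And>i. i \<in> A \<Longrightarrow> f i \<le> c * g i"
  shows "infsum f A \<le> c * infsum g A"
proof (rule infsum_ennreal_le)
  fix F assume F: "finite F" "F \<subseteq> A"
  have "sum f F \<le> (\<Sum>i\<in>F. c * g i)"
    using F assms by (intro sum_mono) auto
  also have "\<dots> = c * sum g F"
    by (simp add: sum_distrib_left)
  also have "\<dots> \<le> c * infsum g A"
    by (intro mult_left_mono sum_le_infsum_ennreal F) auto
  finally show "sum f F \<le> c * infsum g A" .
qed

lemma infsum_ennreal_group_le:
  fixes f :: "'a \<Rightarrow> ennreal"
  assumes "h ` A \<subseteq> N"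
    and "\<And>n. n \<in> N \<Longrightarrow> infsum f {x \<in> A. h x = n} \<le> a n"
  shows "infsum f A \<le> infsum a N"
proof (rule infsum_ennreal_le)
  fix F assume F: "finite F" "F \<subseteq> A"
  have "sum f F = (\<Sum>n\<in>h ` F. sum f {x \<in> F. h x = n})"
    using F by (simp add: sum.image_gen[of F f h])
  also have "\<dots> \<le> (\<Sum>n\<in>h ` F. a n)"
  proof (rule sum_mono)
    fix n assume "n \<in> h ` F"
    have "sum f {x \<in> F. h x = n} \<le> infsum f {x \<in> A. h x = n}"
      using F by (intro sum_le_infsum_ennreal) auto
    also have "\<dots> \<le> a n"
      using \<open>n \<in> h ` F\<close> F assms by auto
    finally show "sum f {x \<in> F. h x = n} \<le> a n" .
  qed
  also have "\<dots> \<le> infsum a N"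
    using F assms by (intro sum_le_infsum_ennreal) auto
  finally show "sum f F \<le> infsum a N" .
qed

text \<open>
  If every \<open>g w\<close> is paid for by the part of the sum of \<open>f\<close> over \<open>A w\<close>, and these parts are disjoint,
  then the sum of \<open>g\<close> is paid for by the sum of \<open>f\<close>.
\<close>

lemma infsum_ennreal_disjoint_le:
  fixes f :: "'a \<Rightarrow> ennreal"
  assumes "disjoint_family_on A W" "\<And>w. w \<in> W \<Longrightarrow> A w \<subseteq> I"
    and "\<And>w. w \<in> W \<Longrightarrow> g w \<le> infsum f (A w)"
  shows "infsum g W \<le> infsum f I"
proof (rule infsum_ennreal_le)
  fix F assume F: "finite F" "F \<subseteq> W"
  then have "sum g F \<le> infsum f (\<Union>w\<in>F. A w)"
  proof (induction F)
    case (insert w F)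
    have "A w \<inter> (\<Union>v\<in>F. A v) = {}"
      using insert.hyps insert.prems assms(1) by (fastforce simp: disjoint_family_on_def)
    then have "infsum f (\<Union>v\<in>insert w F. A v) = infsum f (A w) + infsum f (\<Union>v\<in>F. A v)"
      by (simp add: infsum_Un_disjoint)
    with insert assms(3)[of w] show ?case
      by (auto intro: add_mono)
  qed simp
  also have "\<dots> \<le> infsum f I"
    using F assms(2) by (intro infsum_mono_neutral) auto
  finally show "sum g F \<le> infsum f I" .
qed

lemma infsum_ennreal_Plus:
  fixes f :: "'a + 'b \<Rightarrow> ennreal"
  shows "infsum f (A <+> B) = infsum (f \<circ> Inl) A + infsum (f \<circ> Inr) B"
proof -
  have "infsum f (A <+> B) = infsum f (Inl ` A) + infsum f (Inr ` B)"
    unfolding Plus_def by (rule infsum_Un_disjoint) auto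
  then show ?thesis
    by (simp add: infsum_reindex)
qed

lemma emeasure_UN_le_infsum:
  fixes V :: "nat \<Rightarrow> 'a set"
  assumes "\<And>i. i \<in> I \<Longrightarrow> V i \<in> sets M"
  shows "emeasure M (\<Union>i\<in>I. V i) \<le> (\<Sum>\<^sub>\<infinity>i\<in>I. emeasure M (V i))"
proof -
  define W where "W i = (if i \<in> I then V i else {})" for i
  have "(\<Union>i\<in>I. V i) = (\<Union>i. W i)"
    by (auto simp: W_def split: if_splits)
  then have "emeasure M (\<Union>i\<in>I. V i) \<le> (\<Sum>i. emeasure M (W i))"
    using emeasure_subadditive_countably[of W M] assms by (auto simp: W_def)
  also have "\<dots> = (SUP n. \<Sum>i<n. emeasure M (W i))"
    by (rule suminf_eq_SUP)
  also have "\<dots> \<le> (\<Sum>\<^sub>\<infinity>i\<in>I. emeasure M (V i))"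
  proof (rule SUP_least)
    fix n
    have "(\<Sum>i<n. emeasure M (W i)) = (\<Sum>i\<in>{..<n} \<inter> I. emeasure M (V i))"
      by (intro sum.mono_neutral_cong_right) (auto simp: W_def)
    also have "\<dots> \<le> (\<Sum>\<^sub>\<infinity>i\<in>I. emeasure M (V i))"
      by (rule sum_le_infsum_ennreal) auto
    finally show "(\<Sum>i<n. emeasure M (W i)) \<le> (\<Sum>\<^sub>\<infinity>i\<in>I. emeasure M (V i))" .
  qed
  finally show ?thesis .
qed

section \<open>Balls and diameters for the sup norm\<close>

lemma mem_sup_cball: "y \<in> sup_cball x r \<longleftrightarrow> infnorm (y - x) \<le> r"
  by (simp add: sup_cball_def)

lemma closed_sup_cball: "closed (sup_cball x r)"
  unfolding sup_cball_def by (intro closed_Collect_le continuous_intros)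

lemma sets_sup_cball [measurable]: "sup_cball x r \<in> sets borel"
  by (simp add: closed_sup_cball borel_closed)

lemma infnorm_triangle_dist: "infnorm (x - z) \<le> infnorm (x - y) + infnorm (y - z)"
  using infnorm_triangle[of "x - y" "y - z"] by simp

lemma sup_diameter_le:
  assumes "\<And>x y. x \<in> S \<Longrightarrow> y \<in> S \<Longrightarrow> infnorm (x - y) \<le> b" "0 \<le> b"
  shows "sup_diameter S \<le> b"
  using assms unfolding sup_diameter_def by (auto intro!: cSUP_least)

lemma infnorm_le_sup_diameter:
  assumes "bounded S" "x \<in> S" "y \<in> S"
  shows "infnorm (x - y) \<le> sup_diameter S"
proof -
  obtain B where B: "\<And>z. z \<in> S \<Longrightarrow> norm z \<le> B"
    using assms(1) by (auto simp: bounded_iff)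
  have "infnorm (a - b) \<le> 2 * B" if "a \<in> S" "b \<in> S" for a b
    using infnorm_le_norm[of "a - b"] norm_triangle_ineq4[of a b] B[OF that(1)] B[OF that(2)]
    by linarith
  then have "bdd_above ((\<lambda>(x, y). infnorm (x - y)) ` (S \<times> S))"
    by (intro bdd_aboveI[of _ "2 * B"]) auto
  then have "(case (x, y) of (x, y) \<Rightarrow> infnorm (x - y))
      \<le> (SUP (x, y)\<in>S \<times> S. infnorm (x - y))"
    using assms by (intro cSUP_upper) auto
  then show ?thesis
    using assms by (auto simp: sup_diameter_def)
qed

lemma sup_diameter_nonneg:
  assumes "bounded S"
  shows "0 \<le> sup_diameter S"
proof (cases "S = {}")
  case False
  then obtain a where "a \<in> S" by auto
  then show ?thesis
    using infnorm_le_sup_diameter[OF assms, of a a] by (simp add: infnorm_0)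
qed (simp add: sup_diameter_def)

lemma norm_le_sqrt_infnorm:
  "norm (x :: real ^ 'd) \<le> sqrt (real DIM(real ^ 'd)) * infnorm x"
  by (rule norm_le_infnorm)

lemma bounded_sup_cball: "bounded (sup_cball (x :: real ^ 'd) r)"
proof -
  have "dist x y \<le> sqrt (real DIM(real ^ 'd)) * r" if "y \<in> sup_cball x r" for y
  proof -
    have "dist x y \<le> sqrt (real DIM(real ^ 'd)) * infnorm (y - x)"
      using norm_le_sqrt_infnorm[of "y - x"] by (simp add: dist_norm norm_minus_commute)
    also have "\<dots> \<le> sqrt (real DIM(real ^ 'd)) * r"
      using that by (intro mult_left_mono) (auto simp: mem_sup_cball)
    finally show ?thesis .
  qed
  then show ?thesis
    by (meson bounded_def)
qed

lemma radius_le_sup_diameter_sup_cball: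
  assumes "0 \<le> r"
  shows "r \<le> sup_diameter (sup_cball (x :: real ^ 'd) r)"
proof -
  have "infnorm (axis undefined 1 :: real ^ 'd) \<noteq> 0"
    by (simp add: infnorm_eq_0 axis_eq_0_iff)
  then obtain e :: "real ^ 'd" where e: "infnorm e = 1"
    by (metis abs_inverse infnorm_mul left_inverse real_abs_infnorm)
  have "x + r *\<^sub>R e \<in> sup_cball x r" "x \<in> sup_cball x r"
    using e assms by (auto simp: mem_sup_cball infnorm_mul infnorm_0)
  then have "infnorm ((x + r *\<^sub>R e) - x) \<le> sup_diameter (sup_cball x r)"
    by (intro infnorm_le_sup_diameter bounded_sup_cball)
  then show ?thesis
    using e assms by (simp add: infnorm_mul)
qed

lemma diameter_pow_le:
  assumes "bounded S" "\<And>x y. x \<in> S \<Longrightarrow> y \<in> S \<Longrightarrow> infnorm (x - y) \<le> b" "0 < b" "0 \<le> s"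
  shows "diameter_pow s S \<le> ennreal (b powr s)"
  using assms sup_diameter_le[of S b] sup_diameter_nonneg[of S]
  by (auto simp: diameter_pow_def intro!: ennreal_leI powr_mono2)

lemma diameter_pow_sup_cball_le:
  assumes "0 < r" "0 \<le> s"
  shows "diameter_pow s (sup_cball x r) \<le> ennreal ((2 * r) powr s)"
proof (rule diameter_pow_le)
  fix y z assume "y \<in> sup_cball x r" "z \<in> sup_cball x r"
  then show "infnorm (y - z) \<le> 2 * r"
    using infnorm_triangle_dist[of y z x] by (simp add: mem_sup_cball infnorm_sub[of x z])
qed (use assms bounded_sup_cball in auto)

lemma powr_radius_le_diameter_pow:
  assumes "0 < r" "0 \<le> s"
  shows "ennreal (r powr s) \<le> diameter_pow s (sup_cball x r)"
proof -
  have "x \<in> sup_cball x r"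
    using assms by (simp add: mem_sup_cball infnorm_0)
  then show ?thesis
    using assms radius_le_sup_diameter_sup_cball[of r x]
    by (auto simp: diameter_pow_def intro!: ennreal_leI powr_mono2)
qed

section \<open>Hausdorff contents and premeasures\<close>

lemma infsum_countable_to_nat:
  assumes "countable I"
  obtains J :: "nat set" and h where "bij_betw h J I"
    "\<And>f :: 'a \<Rightarrow> ennreal. (\<Sum>\<^sub>\<infinity>j\<in>J. f (h j)) = infsum f I"
proof -
  have "bij_betw (from_nat_into I) (to_nat_on I ` I) I"
    using assms by (intro bij_betwI[of _ _ _ "to_nat_on I"]) (auto)
  then show ?thesis
    using that infsum_reindex_bij_betw by metis
qed

lemma hausdorff_content_le:
  assumes "countable I" "\<And>i. i \<in> I \<Longrightarrow> 0 < r i" "E \<subseteq> (\<Union>i\<in>I. sup_cball (x i) (r i))"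
  shows "hausdorff_content s E \<le> (\<Sum>\<^sub>\<infinity>i\<in>I. diameter_pow s (sup_cball (x i) (r i)))"
proof -
  obtain J :: "nat set" and h where h: "bij_betw h J I"
    "\<And>f :: _ \<Rightarrow> ennreal. (\<Sum>\<^sub>\<infinity>j\<in>J. f (h j)) = infsum f I"
    using infsum_countable_to_nat[OF assms(1)] by blast
  have hJ: "h ` J = I"
    using h(1) by (simp add: bij_betw_def)
  show ?thesis
    unfolding hausdorff_content_def
  proof (rule Inf_lower, rule CollectI, intro exI conjI)
    show "(\<Sum>\<^sub>\<infinity>i\<in>I. diameter_pow s (sup_cball (x i) (r i)))
        = (\<Sum>\<^sub>\<infinity>j\<in>J. diameter_pow s (sup_cball ((x \<circ> h) j) ((r \<circ> h) j)))"
      using h(2)[of "\<lambda>i. diameter_pow s (sup_cball (x i) (r i))"] by simp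
    show "\<forall>i\<in>J. 0 < (r \<circ> h) i"
      using assms(2) hJ by auto
    show "E \<subseteq> (\<Union>i\<in>J. sup_cball ((x \<circ> h) i) ((r \<circ> h) i))"
      using assms(3) hJ by fastforce
  qed
qed

lemma hausdorff_premeasure_le:
  assumes "countable I" "\<And>i. i \<in> I \<Longrightarrow> bounded (V i) \<and> sup_diameter (V i) \<le> \<delta>"
    "E \<subseteq> (\<Union>i\<in>I. V i)"
  shows "hausdorff_premeasure \<delta> s E \<le> (\<Sum>\<^sub>\<infinity>i\<in>I. diameter_pow s (V i))"
proof -
  obtain J :: "nat set" and h where h: "bij_betw h J I"
    "\<And>f :: _ \<Rightarrow> ennreal. (\<Sum>\<^sub>\<infinity>j\<in>J. f (h j)) = infsum f I"
    using infsum_countable_to_nat[OF assms(1)] by blast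
  have hJ: "h ` J = I"
    using h(1) by (simp add: bij_betw_def)
  show ?thesis
    unfolding hausdorff_premeasure_def
  proof (rule Inf_lower, rule CollectI, intro exI conjI)
    show "(\<Sum>\<^sub>\<infinity>i\<in>I. diameter_pow s (V i)) = (\<Sum>\<^sub>\<infinity>j\<in>J. diameter_pow s ((V \<circ> h) j))"
      using h(2)[of "\<lambda>i. diameter_pow s (V i)"] by simp
    show "\<forall>i\<in>J. bounded ((V \<circ> h) i) \<and> sup_diameter ((V \<circ> h) i) \<le> \<delta>"
      using assms(2) hJ by auto
    show "E \<subseteq> (\<Union>i\<in>J. (V \<circ> h) i)"
      using assms(3) hJ by fastforce
  qed
qed

lemma hausdorff_premeasure_mono:
  assumes "E \<subseteq> F"
  shows "hausdorff_premeasure \<delta> s E \<le> hausdorff_premeasure \<delta> s F"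
  unfolding hausdorff_premeasure_def using assms by (intro Inf_superset_mono) blast

text \<open>
  Countable subadditivity. With strict upper bounds \<open>a n\<close>, no summable error terms are needed when
  coverings are chosen.
\<close>

lemma hausdorff_premeasure_UN_le:
  fixes E :: "nat \<Rightarrow> (real ^ 'd) set"
  assumes "\<And>n. n \<in> N \<Longrightarrow> hausdorff_premeasure \<delta> s (E n) < a n"
  shows "hausdorff_premeasure \<delta> s (\<Union>n\<in>N. E n) \<le> infsum a N"
proof -
  have "\<exists>(I :: nat set) V. (\<forall>i\<in>I. bounded (V i) \<and> sup_diameter (V i) \<le> \<delta>)
      \<and> E n \<subseteq> (\<Union>i\<in>I. V i) \<and> (\<Sum>\<^sub>\<infinity>i\<in>I. diameter_pow s (V i)) < a n" if "n \<in> N" for n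
    using assms[OF that] unfolding hausdorff_premeasure_def Inf_less_iff by auto
  then obtain I :: "nat \<Rightarrow> nat set" and V where
    V: "\<And>n i. n \<in> N \<Longrightarrow> i \<in> I n \<Longrightarrow> bounded (V n i) \<and> sup_diameter (V n i) \<le> \<delta>"
    and E: "\<And>n. n \<in> N \<Longrightarrow> E n \<subseteq> (\<Union>i\<in>I n. V n i)"
    and less: "\<And>n. n \<in> N \<Longrightarrow> (\<Sum>\<^sub>\<infinity>i\<in>I n. diameter_pow s (V n i)) < a n"
    by metis
  have "hausdorff_premeasure \<delta> s (\<Union>n\<in>N. E n)
      \<le> (\<Sum>\<^sub>\<infinity>q\<in>Sigma N I. diameter_pow s (case q of (n, i) \<Rightarrow> V n i))"
    using V E by (intro hausdorff_premeasure_le) fastforce+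
  also have "\<dots> \<le> infsum a N"
  proof (rule infsum_ennreal_group_le[where h = fst])
    fix n assume n: "n \<in> N"
    have "{q \<in> Sigma N I. fst q = n} = Pair n ` I n"
      using n by auto
    then have "(\<Sum>\<^sub>\<infinity>q\<in>{q \<in> Sigma N I. fst q = n}. diameter_pow s (case q of (n, i) \<Rightarrow> V n i))
        = (\<Sum>\<^sub>\<infinity>i\<in>I n. diameter_pow s (V n i))"
      by (simp add: infsum_reindex inj_on_def o_def)
    then show "(\<Sum>\<^sub>\<infinity>q\<in>{q \<in> Sigma N I. fst q = n}. diameter_pow s (case q of (n, i) \<Rightarrow> V n i))
        \<le> a n"
      using less[OF n] by simp
  qed auto
  finally show ?thesis .
qed

lemma mult_Inf_ennreal_ge:
  fixes c y :: ennreal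
  assumes "c \<noteq> 0" "c \<noteq> \<top>" "\<And>u. u \<in> S \<Longrightarrow> y \<le> c * u"
  shows "y \<le> c * Inf S"
proof -
  have "y / c \<le> Inf S"
  proof (rule Inf_greatest)
    fix u assume "u \<in> S"
    then show "y / c \<le> u"
      using assms(1,3) by (intro divide_le_posI_ennreal) (simp_all add: zero_less_iff_neq_zero)
  qed
  then have "c * (y / c) \<le> c * Inf S"
    by (rule mult_left_mono) simp
  moreover have "c * (y / c) = y"
    using assms(1,2) mult_divide_eq_ennreal[of c y] by (simp add: ennreal_times_divide mult.commute)
  ultimately show ?thesis
    by simp
qed

text \<open>
  A covering by balls becomes a covering by small sets after intersecting with the ball that
  contains the covered set, and one gains a power of the radius of this ball.
\<close>

lemma hausdorff_premeasure_le_content: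
  fixes E :: "(real ^ 'd) set"
  assumes "E \<subseteq> sup_cball z r" "0 < r" "2 * r \<le> \<delta>" "0 \<le> s" "s < t"
  shows "hausdorff_premeasure \<delta> t E
    \<le> ennreal ((2 * r) powr (t - s) * 2 powr s) * hausdorff_content s E"
  unfolding hausdorff_content_def
proof (rule mult_Inf_ennreal_ge)
  fix u assume "u \<in> {(\<Sum>\<^sub>\<infinity>i\<in>I. diameter_pow s (sup_cball (x i) (r i))) | (I :: nat set) x r.
            (\<forall>i\<in>I. 0 < r i) \<and> E \<subseteq> (\<Union>i\<in>I. sup_cball (x i) (r i))}"
  then obtain I :: "nat set" and x q where q: "\<And>i. i \<in> I \<Longrightarrow> 0 < q i"
    and E: "E \<subseteq> (\<Union>i\<in>I. sup_cball (x i) (q i))"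
    and u: "u = (\<Sum>\<^sub>\<infinity>i\<in>I. diameter_pow s (sup_cball (x i) (q i)))"
    by blast
  define V where "V i = sup_cball (x i) (q i) \<inter> sup_cball z r" for i
  have "hausdorff_premeasure \<delta> t E \<le> (\<Sum>\<^sub>\<infinity>i\<in>I. diameter_pow t (V i))"
  proof (rule hausdorff_premeasure_le)
    show "E \<subseteq> (\<Union>i\<in>I. V i)"
      using E assms(1) by (auto simp: V_def)
    fix i
    have "sup_diameter (V i) \<le> 2 * r"
    proof (rule sup_diameter_le)
      fix y y' assume "y \<in> V i" "y' \<in> V i"
      then show "infnorm (y - y') \<le> 2 * r"
        using infnorm_triangle_dist[of y y' z]
        by (simp add: V_def mem_sup_cball infnorm_sub[of z y'])
    qed (use assms in simp)
    then show "bounded (V i) \<and> sup_diameter (V i) \<le> \<delta>"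
      using assms(3) bounded_sup_cball by (auto simp: V_def)
  qed simp
  also have "\<dots> \<le> ennreal ((2 * r) powr (t - s) * 2 powr s) * u"
    unfolding u
  proof (rule infsum_ennreal_cmult_le)
    fix i assume i: "i \<in> I"
    let ?b = "min (2 * r) (2 * q i)"
    have "diameter_pow t (V i) \<le> ennreal (?b powr t)"
    proof (rule diameter_pow_le)
      fix y y' assume "y \<in> V i" "y' \<in> V i"
      then show "infnorm (y - y') \<le> ?b"
        using infnorm_triangle_dist[of y y' z] infnorm_triangle_dist[of y y' "x i"]
        by (simp add: V_def mem_sup_cball infnorm_sub[of z y'] infnorm_sub[of "x i" y'])
    qed (use assms q[OF i] bounded_sup_cball in \<open>auto simp: V_def\<close>)
    also have "?b powr t = ?b powr (t - s) * ?b powr s"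
      by (simp add: powr_add[symmetric])
    also have "\<dots> \<le> (2 * r) powr (t - s) * (2 * q i) powr s"
      using assms q[OF i] by (intro mult_mono powr_mono2) auto
    also have "\<dots> = ((2 * r) powr (t - s) * 2 powr s) * q i powr s"
      using q[OF i] by (simp add: powr_mult)
    finally have "diameter_pow t (V i)
        \<le> ennreal (((2 * r) powr (t - s) * 2 powr s) * q i powr s)"
      by (simp add: ennreal_leI)
    also have "\<dots> = ennreal ((2 * r) powr (t - s) * 2 powr s) * ennreal (q i powr s)"
      by (rule ennreal_mult) auto
    also have "\<dots> \<le> ennreal ((2 * r) powr (t - s) * 2 powr s)
        * diameter_pow s (sup_cball (x i) (q i))"
      using q[OF i] assms by (intro mult_left_mono powr_radius_le_diameter_pow) auto
    finally show "diameter_pow t (V i) \<le> ennreal ((2 * r) powr (t - s) * 2 powr s)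
        * diameter_pow s (sup_cball (x i) (q i))" .
  qed
  finally show "hausdorff_premeasure \<delta> t E
    \<le> ennreal ((2 * r) powr (t - s) * 2 powr s) * u" .
qed (use assms in auto)

lemma hausdorff_dim_leI:
  assumes "0 \<le> s" "\<And>t \<delta>. s < t \<Longrightarrow> 0 < \<delta> \<Longrightarrow> hausdorff_premeasure \<delta> t E = 0"
  shows "hausdorff_dim E \<le> ennreal s"
proof (rule ennreal_le_epsilon)
  fix e :: real assume "0 < e"
  have "hausdorff_measure (s + e) E = 0"
    unfolding hausdorff_measure_def using assms \<open>0 < e\<close> by simp
  then have "ennreal (s + e) \<in> {ennreal s | s. 0 \<le> s \<and> hausdorff_measure s E = 0}"
    using assms \<open>0 < e\<close> by (intro CollectI exI[of _ "s + e"]) simp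
  then have "hausdorff_dim E \<le> ennreal (s + e)"
    unfolding hausdorff_dim_def by (rule Inf_lower)
  then show "hausdorff_dim E \<le> ennreal s + ennreal e"
    using assms \<open>0 < e\<close> by (simp add: ennreal_plus)
qed

section \<open>Covers of sets of full measure\<close>

text \<open>
  Since \<open>s\<close> is smaller than the dimension, almost every point has balls of measure at most
  \<open>\<rho>\<^sup>s\<close> at all small scales. The range of admissible \<open>\<rho>\<close> depends on the point.
\<close>

lemma exact_dimension_ball_le:
  assumes "has_exact_dimension \<mu> D" "s < D" "0 \<le> s"
  shows "AE y in \<mu>. \<exists>N::nat. \<forall>\<rho>. 0 < \<rho> \<longrightarrow> \<rho> < 1 / Suc N \<longrightarrow>
    measure \<mu> (sup_cball y \<rho>) \<le> \<rho> powr s"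
  using assms(1) unfolding has_exact_dimension_def
proof eventually_elim
  fix y assume "((\<lambda>r. ln (measure \<mu> (sup_cball y r)) / ln r) \<longlongrightarrow> D) (at_right 0)"
  then have "\<forall>\<^sub>F r in at_right 0. s < ln (measure \<mu> (sup_cball y r)) / ln r"
    using \<open>s < D\<close> by (rule order_tendstoD)
  then obtain b where b: "0 < b"
    "\<And>r. 0 < r \<Longrightarrow> r < b \<Longrightarrow> s < ln (measure \<mu> (sup_cball y r)) / ln r"
    by (auto simp: eventually_at_right_field)
  obtain N :: nat where N: "1 / real (Suc N) < b"
    using b(1) nat_approx_posE by blast
  \<comment> \<open>The case of measure zero is separate, because \<open>ln 0 = 0\<close>.\<close>
  have "measure \<mu> (sup_cball y r) \<le> r powr s" if "0 < r" "r < 1 / Suc N" for r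
  proof (cases "measure \<mu> (sup_cball y r) = 0")
    case False
    then have pos: "0 < measure \<mu> (sup_cball y r)"
      by (simp add: zero_less_measure_iff)
    have "1 / real (Suc N) \<le> 1"
      by simp
    then have "r < 1"
      using that(2) by linarith
    then have "ln r < 0"
      using that by simp
    then have "ln (measure \<mu> (sup_cball y r)) < s * ln r"
      using b(2)[of r] that N by (simp add: field_simps)
    then show ?thesis
      using pos that by (simp add: powr_def flip: ln_le_cancel_iff)
  qed simp
  then show "\<exists>N::nat. \<forall>\<rho>. 0 < \<rho> \<longrightarrow> \<rho> < 1 / Suc N \<longrightarrow>
      measure \<mu> (sup_cball y \<rho>) \<le> \<rho> powr s"
    by blast
qed

text \<open>
  The sets \<open>F N\<close> need not be measurable. If countably many sets cover almost every point, then at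
  least one of them has positive outer measure.
\<close>

lemma (in prob_space) AE_UN_outer_measure:
  fixes F :: "nat \<Rightarrow> 'a set"
  assumes "AE y in M. \<exists>N. y \<in> F N"
  obtains N \<eta> where "0 < (\<eta>::real)" "\<And>G. G \<in> sets M \<Longrightarrow> F N \<subseteq> G \<Longrightarrow> \<eta> \<le> measure M G"
proof (rule ccontr)
  assume "\<not> thesis"
  then have *: "\<not> (0 < \<eta> \<and> (\<forall>G. G \<in> sets M \<longrightarrow> F N \<subseteq> G \<longrightarrow> \<eta> \<le> measure M G))"
    for N and \<eta> :: real
    using that by blast
  have "\<exists>G. G \<in> sets M \<and> F N \<subseteq> G \<and> measure M G < 1 / real (Suc k)" for N k
    using *[of "1 / real (Suc k)" N] by (auto simp: not_le)
  then obtain G where G: "\<And>N k. G N k \<in> sets M" "\<And>N k. F N \<subseteq> G N k"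
    "\<And>N k. measure M (G N k) < 1 / real (Suc k)"
    by metis
  have "measure M (\<Inter>k. G N k) \<le> 0" for N
  proof (rule field_le_epsilon)
    fix e :: real assume "0 < e"
    then obtain k :: nat where k: "1 / real (Suc k) < e"
      using nat_approx_posE by blast
    have "measure M (\<Inter>k. G N k) \<le> measure M (G N k)"
      using G(1) by (intro finite_measure_mono) auto
    then show "measure M (\<Inter>k. G N k) \<le> 0 + e"
      using G(3)[of N k] k by linarith
  qed
  then have "(\<Inter>k. G N k) \<in> null_sets M" for N
    using G(1) by (intro null_setsI) (auto simp: emeasure_eq_measure measure_le_0_iff)
  then have "AE y in M. \<forall>N. y \<notin> (\<Inter>k. G N k)"
    unfolding AE_all_countable by (intro allI AE_not_in)
  with assms have "AE y in M. False"
  proof eventually_elim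
    case (elim y)
    then show ?case
      using G(2) by blast
  qed
  then show False
    by simp
qed

text \<open>
  A mass distribution principle: a set of full measure cannot be covered cheaply. One set
  \<open>F N\<close> of points whose balls of radius \<open>\<rho> < 1 / (N + 1)\<close> have measure at most \<open>\<rho>\<^sup>s\<close> has positive
  outer measure, and the members of the cover that meet \<open>F N\<close> have measure at most a
  constant times \<open>\<rho> i powr s\<close>. The covering sets are arbitrary Borel sets, not balls, because
  preimages of sup norm balls under similarities need not be balls.
\<close>

lemma full_measure_cover_lower_bound:
  fixes \<mu> :: "(real ^ 'd) measure"
  assumes "has_exact_dimension \<mu> D" "s < D" "0 \<le> s" "prob_space \<mu>" "sets \<mu> = sets borel"
  obtains \<eta> :: real where "0 < \<eta>"
    "\<And>(I :: nat set) V \<rho>. (\<And>i. i \<in> I \<Longrightarrow> V i \<in> sets borel) \<Longrightarrow>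
       (\<And>i. i \<in> I \<Longrightarrow> 0 < \<rho> i) \<Longrightarrow>
       (\<And>i y z. i \<in> I \<Longrightarrow> y \<in> V i \<Longrightarrow> z \<in> V i \<Longrightarrow> infnorm (z - y) \<le> \<rho> i) \<Longrightarrow>
       (AE y in \<mu>. y \<in> (\<Union>i\<in>I. V i)) \<Longrightarrow>
       ennreal \<eta> \<le> (\<Sum>\<^sub>\<infinity>i\<in>I. ennreal (\<rho> i powr s))"
proof -
  interpret prob_space \<mu> by fact
  have space: "space \<mu> = UNIV"
    using sets_eq_imp_space_eq[OF assms(5)] by simp
  define F where "F N = {y. \<forall>\<rho>. 0 < \<rho> \<longrightarrow> \<rho> < 1 / real (Suc N) \<longrightarrow>
    measure \<mu> (sup_cball y \<rho>) \<le> \<rho> powr s}" for N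
  have "AE y in \<mu>. \<exists>N. y \<in> F N"
    using exact_dimension_ball_le[OF assms(1-3)] by (simp add: F_def)
  then obtain N \<eta> where \<eta>: "0 < (\<eta>::real)"
    "\<And>G. G \<in> sets \<mu> \<Longrightarrow> F N \<subseteq> G \<Longrightarrow> \<eta> \<le> measure \<mu> G"
    using AE_UN_outer_measure by blast
  define c where "c = real (Suc N) powr s"
  have c: "1 \<le> c"
    using assms(3) by (simp add: c_def ge_one_powr_ge_zero)
  show thesis
  proof (rule that[of "\<eta> / c"])
    show "0 < \<eta> / c"
      using \<eta> c by simp
    fix I :: "nat set" and V and \<rho> :: "nat \<Rightarrow> real"
    assume V: "\<And>i. i \<in> I \<Longrightarrow> V i \<in> sets borel" and \<rho>: "\<And>i. i \<in> I \<Longrightarrow> 0 < \<rho> i"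
      and diam: "\<And>i y z. i \<in> I \<Longrightarrow> y \<in> V i \<Longrightarrow> z \<in> V i \<Longrightarrow> infnorm (z - y) \<le> \<rho> i"
      and AE: "AE y in \<mu>. y \<in> (\<Union>i\<in>I. V i)"
    define I' where "I' = {i \<in> I. V i \<inter> F N \<noteq> {}}"
    have bound: "emeasure \<mu> (V i) \<le> ennreal c * ennreal (\<rho> i powr s)" if i: "i \<in> I'" for i
    proof -
      obtain y where y: "y \<in> V i" "y \<in> F N"
        using i by (auto simp: I'_def)
      have "measure \<mu> (V i) \<le> c * \<rho> i powr s"
      proof (cases "\<rho> i < 1 / real (Suc N)")
        case True
        have "V i \<subseteq> sup_cball y (\<rho> i)"
          using diam i y by (auto simp: mem_sup_cball I'_def)
        then have "measure \<mu> (V i) \<le> measure \<mu> (sup_cball y (\<rho> i))"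
          by (intro finite_measure_mono) (simp_all add: assms(5) sets_sup_cball)
        also have "\<dots> \<le> \<rho> i powr s"
          using y True \<rho> i by (simp add: F_def I'_def)
        also have "\<dots> \<le> c * \<rho> i powr s"
          using c mult_right_mono[of 1 c "\<rho> i powr s"] by simp
        finally show ?thesis .
      next
        case False
        then have "1 \<le> real (Suc N) * \<rho> i"
          by (simp add: field_simps)
        then have "1 \<le> (real (Suc N) * \<rho> i) powr s"
          using assms(3) by (rule ge_one_powr_ge_zero)
        also have "\<dots> = c * \<rho> i powr s"
          using \<rho>[of i] i by (simp add: c_def powr_mult I'_def)
        finally show ?thesis
          using prob_le_1[of "V i"] by linarith
      qed
      then have "emeasure \<mu> (V i) \<le> ennreal (c * \<rho> i powr s)"
        by (simp add: emeasure_eq_measure ennreal_leI)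
      also have "\<dots> = ennreal c * ennreal (\<rho> i powr s)"
        using c by (intro ennreal_mult) auto
      finally show ?thesis .
    qed
    let ?A = "\<Union>i\<in>I. V i" and ?A' = "\<Union>i\<in>I'. V i"
    have meas: "?A \<in> sets \<mu>" "?A' \<in> sets \<mu>"
      using V by (auto simp: assms(5) I'_def intro!: sets.countable_UN')
    have null: "emeasure \<mu> (- ?A) = 0"
      using AE_iff_measurable[of "- ?A" \<mu> "\<lambda>y. y \<in> ?A"] AE meas space
      by (auto simp: Compl_eq_Diff_UNIV assms(5) Collect_neg_eq)
    have "F N \<subseteq> ?A' \<union> - ?A"
      by (auto simp: I'_def)
    moreover have "?A' \<union> - ?A \<in> sets \<mu>"
      using meas sets.compl_sets[OF meas(1)] space by (auto simp: Compl_eq_Diff_UNIV)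
    ultimately have "\<eta> \<le> measure \<mu> (?A' \<union> - ?A)"
      using \<eta>(2) by blast
    then have "ennreal \<eta> \<le> emeasure \<mu> (?A' \<union> - ?A)"
      by (simp add: emeasure_eq_measure ennreal_leI)
    also have "\<dots> \<le> emeasure \<mu> ?A' + emeasure \<mu> (- ?A)"
      using meas sets.compl_sets[OF meas(1)] space
      by (intro emeasure_subadditive) (auto simp: Compl_eq_Diff_UNIV)
    also have "\<dots> = emeasure \<mu> ?A'"
      using null by simp
    also have "\<dots> \<le> (\<Sum>\<^sub>\<infinity>i\<in>I'. emeasure \<mu> (V i))"
      using V by (intro emeasure_UN_le_infsum) (auto simp: assms(5) I'_def)
    also have "\<dots> \<le> ennreal c * (\<Sum>\<^sub>\<infinity>i\<in>I'. ennreal (\<rho> i powr s))"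
      by (intro infsum_ennreal_cmult_le bound)
    also have "\<dots> \<le> ennreal c * (\<Sum>\<^sub>\<infinity>i\<in>I. ennreal (\<rho> i powr s))"
      by (intro mult_left_mono infsum_mono_neutral) (auto simp: I'_def)
    finally have le: "ennreal \<eta> \<le> ennreal c * (\<Sum>\<^sub>\<infinity>i\<in>I. ennreal (\<rho> i powr s))" .
    have "ennreal (\<eta> / c) = ennreal (1 / c) * ennreal \<eta>"
      using c \<eta> by (simp flip: ennreal_mult)
    also have "\<dots> \<le> ennreal (1 / c) * (ennreal c * (\<Sum>\<^sub>\<infinity>i\<in>I. ennreal (\<rho> i powr s)))"
      by (intro mult_left_mono le) simp
    also have "\<dots> = (\<Sum>\<^sub>\<infinity>i\<in>I. ennreal (\<rho> i powr s))"
      using c by (simp add: mult.assoc[symmetric] flip: ennreal_mult)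
    finally show "ennreal (\<eta> / c) \<le> (\<Sum>\<^sub>\<infinity>i\<in>I. ennreal (\<rho> i powr s))" .
  qed
qed

section \<open>Small similar copies of a self-similar measure\<close>

text \<open>
  A similarity \<open>g\<close> of ratio \<open>c\<close> under which preimages of \<open>\<mu>\<close>-null sets are \<open>\<mu>\<close>-null, that is, for
  which the image measure of \<open>\<mu>\<close> under \<open>g\<close> is absolutely continuous with respect to \<open>\<mu>\<close>. The
  compositions \<open>f i\<^sub>1 \<circ> \<dots> \<circ> f i\<^sub>n\<close> of the maps of the iterated function system have this property, as
  \<open>\<mu>\<close> dominates a positive multiple of the image measure.
\<close>

definition null_preserving_similarity ::
    "(real ^ 'd) measure \<Rightarrow> real \<Rightarrow> (real ^ 'd \<Rightarrow> real ^ 'd) \<Rightarrow> bool" where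
  "null_preserving_similarity \<mu> c g \<longleftrightarrow>
     0 < c \<and> (\<forall>x y. dist (g x) (g y) = c * dist x y) \<and>
     (\<forall>A\<in>sets borel. emeasure \<mu> A = 0 \<longrightarrow> emeasure \<mu> (g -` A) = 0)"

lemma borel_vimage_similarity:
  fixes g :: "real ^ 'd \<Rightarrow> real ^ 'd"
  assumes "\<And>x y. dist (g x) (g y) = c * dist x y" "A \<in> sets borel"
  shows "g -` A \<in> sets borel"
proof -
  have "dist (g (axis undefined 1)) (g 0) = c"
    using assms(1)[of "axis undefined 1" 0] by (simp add: norm_axis_1)
  then have "0 \<le> c"
    using zero_le_dist by metis
  then have "c-lipschitz_on UNIV g"
    using assms(1) by (intro lipschitz_onI) auto
  then have "g \<in> borel_measurable borel"
    by (intro borel_measurable_continuous_onI lipschitz_on_continuous_on)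
  from measurable_sets[OF this assms(2)] show ?thesis
    by simp
qed

lemma emeasure_self_similar:
  assumes "self_similar_measure m f p \<mu>" "A \<in> sets borel"
  shows "emeasure \<mu> A = (\<Sum>i=1..m. ennreal (p i) * emeasure \<mu> (f i -` A))"
proof -
  have sets: "sets \<mu> = sets borel" and space: "space \<mu> = UNIV"
    using assms(1) sets_eq_imp_space_eq[of \<mu> borel] by (auto simp: self_similar_measure_def)
  have "emeasure (distr \<mu> borel (f i)) A = emeasure \<mu> (f i -` A)" if i: "i \<in> {1..m}" for i
  proof -
    have "contracting_similarity (f i)"
      using assms(1) i by (simp add: self_similar_measure_def)
    then obtain c where "\<And>x y. dist (f i x) (f i y) = c * dist x y"
      unfolding contracting_similarity_def by blast
    from borel_vimage_similarity[OF this] have "f i \<in> measurable borel borel"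
      by (intro measurableI) simp_all
    then have "f i \<in> measurable \<mu> borel"
      using measurable_cong_sets[OF sets refl] by blast
    then show ?thesis
      using assms(2) space by (simp add: emeasure_distr)
  qed
  then show ?thesis
    using assms by (simp add: self_similar_measure_def)
qed

lemma self_similar_ratios:
  assumes "self_similar_measure m f p \<mu>"
  obtains c a b where "\<And>i x y. i \<in> {1..m} \<Longrightarrow> dist (f i x) (f i y) = c i * dist x y"
    "0 < a" "a \<le> b" "b < (1::real)" "\<And>i. i \<in> {1..m} \<Longrightarrow> a \<le> c i \<and> c i \<le> b"
proof -
  have m: "2 \<le> m" and "\<forall>i\<in>{1..m}. \<exists>c. 0 < c \<and> c < 1 \<and> (\<forall>x y. dist (f i x) (f i y) = c * dist x y)"
    using assms by (auto simp: self_similar_measure_def contracting_similarity_def)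
  then obtain c where c: "\<And>i. i \<in> {1..m} \<Longrightarrow> 0 < c i \<and> c i < 1"
    "\<And>i x y. i \<in> {1..m} \<Longrightarrow> dist (f i x) (f i y) = c i * dist x y"
    by metis
  have ne: "finite (c ` {1..m})" "c ` {1..m} \<noteq> {}"
    using m by auto
  show thesis
  proof (rule that[of c "Min (c ` {1..m})" "Max (c ` {1..m})"])
    show "0 < Min (c ` {1..m})" "Max (c ` {1..m}) < 1"
      using ne c(1) by (subst Min_gr_iff Max_less_iff; auto)+
    show "Min (c ` {1..m}) \<le> Max (c ` {1..m})"
      using ne by (meson Max_ge Min_in)
  qed (use c ne in auto)
qed

lemma self_similar_bounded:
  fixes \<mu> :: "(real ^ 'd) measure"
  assumes "self_similar_measure m f p \<mu>"
  obtains R where "0 < R" "emeasure \<mu> (cball 0 R) = 1"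
proof -
  have sets: "sets \<mu> = sets borel" and space: "space \<mu> = UNIV" and prob: "prob_space \<mu>"
    using assms(1) sets_eq_imp_space_eq[of \<mu> borel] by (auto simp: self_similar_measure_def)
  interpret prob_space \<mu> by fact
  obtain c a b where c: "\<And>i x y. i \<in> {1..m} \<Longrightarrow> dist (f i x) (f i y) = c i * dist x y"
    and ab: "0 < a" "a \<le> b" "b < (1::real)" "\<And>i. i \<in> {1..m} \<Longrightarrow> a \<le> c i \<and> c i \<le> b"
    using self_similar_ratios[OF assms] by blast
  \<comment> \<open>For \<open>T \<ge> R\<close>, every \<open>f i\<close> maps the ball of radius \<open>T + 1\<close> into the ball of radius \<open>T\<close>,
    so that the latter has at least the measure of the former.\<close>
  define h where "h = (\<Sum>i=1..m. norm (f i 0))"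
  have h: "norm (f i 0) \<le> h" if "i \<in> {1..m}" for i
    unfolding h_def using that by (intro member_le_sum) auto
  have h0: "0 \<le> h"
    unfolding h_def by (intro sum_nonneg) auto
  define R where "R = (h + 1) / (1 - b)"
  have R: "0 < R"
    using h0 ab by (simp add: R_def)
  have step: "emeasure \<mu> (cball 0 (T + 1)) \<le> emeasure \<mu> (cball 0 T)" if T: "R \<le> T" for T
  proof -
    have "cball 0 (T + 1) \<subseteq> f i -` cball 0 T" if i: "i \<in> {1..m}" for i
    proof
      fix y :: "real ^ 'd" assume "y \<in> cball 0 (T + 1)"
      then have "dist (f i y) (f i 0) \<le> b * (T + 1)"
        using c[OF i, of y 0] ab(1,2,4) i R T by (auto intro!: mult_mono)
      then have "norm (f i y) \<le> h + b * (T + 1)"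
        using h[OF i] norm_triangle_sub[of "f i y" "f i 0"] by (simp add: dist_norm)
      moreover have "h + 1 \<le> T * (1 - b)"
        using T ab by (simp add: R_def field_simps)
      ultimately show "y \<in> f i -` cball 0 T"
        using ab by (simp add: algebra_simps)
    qed
    then have "(\<Sum>i=1..m. ennreal (p i) * emeasure \<mu> (cball 0 (T + 1)))
        \<le> (\<Sum>i=1..m. ennreal (p i) * emeasure \<mu> (f i -` cball 0 T))"
      using borel_vimage_similarity[OF c]
      by (intro sum_mono mult_left_mono emeasure_mono) (simp_all add: sets)
    also have "\<dots> = emeasure \<mu> (cball 0 T)"
      by (rule emeasure_self_similar[OF assms, symmetric]) simp
    also have "(\<Sum>i=1..m. ennreal (p i) * emeasure \<mu> (cball 0 (T + 1)))
        = ennreal (\<Sum>i=1..m. p i) * emeasure \<mu> (cball 0 (T + 1))"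
    proof -
      have "ennreal (\<Sum>i=1..m. p i) = (\<Sum>i=1..m. ennreal (p i))"
        using assms by (intro sum_ennreal[symmetric])
          (auto simp: self_similar_measure_def less_imp_le)
      then show ?thesis
        by (simp add: sum_distrib_right)
    qed
    also have "\<dots> = emeasure \<mu> (cball 0 (T + 1))"
      using assms by (simp add: self_similar_measure_def)
    finally show ?thesis .
  qed
  have le: "emeasure \<mu> (cball 0 (R + real n)) \<le> emeasure \<mu> (cball 0 R)" for n
  proof (induction n)
    case (Suc n)
    have "emeasure \<mu> (cball 0 (R + real (Suc n))) \<le> emeasure \<mu> (cball 0 (R + real n))"
      using step[of "R + real n"] by (simp add: algebra_simps)
    with Suc show ?case by simp
  qed simp
  have "(\<Union>n. cball 0 (R + real n)) = (UNIV :: (real ^ 'd) set)"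
  proof safe
    fix y :: "real ^ 'd"
    obtain n :: nat where "norm y \<le> real n"
      using real_arch_simple by blast
    then show "y \<in> (\<Union>n. cball 0 (R + real n))"
      using R by (intro UN_I[of n]) auto
  qed auto
  then have "1 = emeasure \<mu> (\<Union>n. cball 0 (R + real n))"
    using emeasure_space_1 space by simp
  also have "\<dots> = (SUP n. emeasure \<mu> (cball 0 (R + real n)))"
    by (rule SUP_emeasure_incseq[symmetric]) (auto simp: sets incseq_def)
  also have "\<dots> \<le> emeasure \<mu> (cball 0 R)"
    by (intro SUP_least le)
  finally show thesis
    using R that emeasure_le_1 by (meson antisym)
qed

text \<open>
  Iterating the self-similarity \<open>n\<close> times: a set of positive measure has a preimage of positive
  measure under some composition of \<open>n\<close> maps.
\<close>

lemma self_similar_copy: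
  fixes \<mu> :: "(real ^ 'd) measure"
  assumes "self_similar_measure m f p \<mu>"
    and f: "\<And>i x y. i \<in> {1..m} \<Longrightarrow> dist (f i x) (f i y) = c i * dist x y"
    and ab: "0 < a" "\<And>i. i \<in> {1..m} \<Longrightarrow> a \<le> c i \<and> c i \<le> b"
    and A: "A \<in> sets borel" "0 < emeasure \<mu> A"
  shows "\<exists>g t. null_preserving_similarity \<mu> t g \<and> a ^ n \<le> t \<and> t \<le> b ^ n
    \<and> 0 < emeasure \<mu> (g -` A)"
  using A
proof (induction n arbitrary: A)
  case 0
  then show ?case
    by (intro exI[of _ "\<lambda>x. x"] exI[of _ 1]) (auto simp: null_preserving_similarity_def)
next
  case (Suc n)
  note eq = emeasure_self_similar[OF assms(1)]
  have "\<exists>i\<in>{1..m}. emeasure \<mu> (f i -` A) \<noteq> 0"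
  proof (rule ccontr)
    assume "\<not> ?thesis"
    then have "emeasure \<mu> A = 0"
      using eq[OF Suc.prems(1)] by simp
    then show False
      using Suc.prems by simp
  qed
  then obtain i where i: "i \<in> {1..m}" "0 < emeasure \<mu> (f i -` A)"
    by (auto simp: zero_less_iff_neq_zero)
  have "f i -` A \<in> sets borel"
    using f[OF i(1)] Suc.prems(1) by (rule borel_vimage_similarity)
  from Suc.IH[OF this i(2)] obtain g t where
    g: "null_preserving_similarity \<mu> t g" "a ^ n \<le> t" "t \<le> b ^ n"
    "0 < emeasure \<mu> (g -` (f i -` A))"
    by blast
  have ci: "a \<le> c i" "c i \<le> b"
    using ab i by auto
  have "null_preserving_similarity \<mu> (c i * t) (f i \<circ> g)"
    unfolding null_preserving_similarity_def
  proof (intro conjI ballI allI impI)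
    show "0 < c i * t"
      using ci ab(1) g(1) by (simp add: null_preserving_similarity_def)
    show "dist ((f i \<circ> g) x) ((f i \<circ> g) y) = c i * t * dist x y" for x y
      using f[OF i(1)] g(1) by (simp add: null_preserving_similarity_def)
    fix B assume B: "B \<in> sets (borel :: (real ^ 'd) measure)" "emeasure \<mu> B = 0"
    then have "ennreal (p i) * emeasure \<mu> (f i -` B) = 0"
      using eq[OF B(1)] i(1) by (simp add: sum_eq_0_iff)
    moreover have "0 < p i"
      using assms(1) i(1) by (simp add: self_similar_measure_def)
    ultimately have "emeasure \<mu> (f i -` B) = 0"
      by simp
    moreover have "f i -` B \<in> sets borel"
      using f[OF i(1)] B(1) by (rule borel_vimage_similarity)
    ultimately show "emeasure \<mu> ((f i \<circ> g) -` B) = 0"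
      using g(1) by (simp add: null_preserving_similarity_def vimage_comp[symmetric])
  qed
  moreover have "a ^ Suc n \<le> c i * t" "c i * t \<le> b ^ Suc n"
    using ci ab(1) g(2,3) less_le_trans[OF zero_less_power[OF ab(1), of n] g(2)]
    by (auto intro!: mult_mono)
  moreover have "0 < emeasure \<mu> ((f i \<circ> g) -` A)"
    using g(4) by (simp add: vimage_comp)
  ultimately show ?case
    by blast
qed

text \<open>
  Near every point of the support there are arbitrarily small similar copies of the measure. The
  factor \<open>2 * R\<close> arises as follows: a composition \<open>g\<close> of \<open>n\<close> maps, of ratio \<open>t\<close>, maps some point of the ball of
  radius \<open>R\<close> to within \<open>R * a ^ n \<le> R * t\<close> of \<open>y\<close>, where \<open>a\<close> bounds the ratios of the \<open>f i\<close> from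
  below, and the image of that ball has radius \<open>R * t\<close>.
\<close>

lemma self_similar_small_copies:
  fixes \<mu> :: "(real ^ 'd) measure"
  assumes "self_similar_measure m f p \<mu>" "emeasure \<mu> (cball 0 R) = 1" "0 < R"
    and "y \<in> measure_support \<mu>" "0 < e"
  obtains g t where "null_preserving_similarity \<mu> t g" "t < e" "dist (g 0) y \<le> 2 * R * t"
proof -
  have sets: "sets \<mu> = sets borel" and space: "space \<mu> = UNIV" and prob: "prob_space \<mu>"
    using assms(1) sets_eq_imp_space_eq[of \<mu> borel] by (auto simp: self_similar_measure_def)
  interpret prob_space \<mu> by fact
  obtain c a b where f: "\<And>i x y. i \<in> {1..m} \<Longrightarrow> dist (f i x) (f i y) = c i * dist x y"
    and ab: "0 < a" "a \<le> b" "b < (1::real)" "\<And>i. i \<in> {1..m} \<Longrightarrow> a \<le> c i \<and> c i \<le> b"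
    using self_similar_ratios[OF assms(1)] by blast
  obtain n where n: "b ^ n < e"
    using real_arch_pow_inv[OF \<open>0 < e\<close> ab(3)] by blast
  have "0 < emeasure \<mu> (ball y (R * a ^ n))"
    using assms(3,4) ab(1) by (simp add: measure_support_def)
  with self_similar_copy[OF assms(1) f ab(1,4), of "ball y (R * a ^ n)" n]
  obtain g t where g: "null_preserving_similarity \<mu> t g" "a ^ n \<le> t" "t \<le> b ^ n"
    "0 < emeasure \<mu> (g -` ball y (R * a ^ n))"
    by auto
  have dist: "dist (g u) (g v) = t * dist u v" for u v
    using g(1) by (simp add: null_preserving_similarity_def)
  have "g -` ball y (R * a ^ n) \<inter> cball 0 R \<noteq> {}"
  proof
    assume "g -` ball y (R * a ^ n) \<inter> cball 0 R = {}"
    then have "g -` ball y (R * a ^ n) \<subseteq> space \<mu> - cball 0 R"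
      using space by auto
    then have "emeasure \<mu> (g -` ball y (R * a ^ n)) \<le> emeasure \<mu> (space \<mu> - cball 0 R)"
      by (intro emeasure_mono) (simp_all add: sets space)
    also have "\<dots> = 0"
      using assms(2) by (simp add: emeasure_compl sets emeasure_space_1)
    finally show False
      using g(4) by simp
  qed
  then obtain z where z: "dist y (g z) < R * a ^ n" "norm z \<le> R"
    by auto
  have "dist (g 0) (g z) \<le> t * R"
    using z(2) g(2) zero_less_power[OF ab(1), of n] by (simp add: dist mult_left_mono)
  moreover have "R * a ^ n \<le> R * t"
    using g(2) assms(3) by simp
  ultimately have "dist (g 0) y \<le> 2 * R * t"
    using z(1) dist_triangle[of "g 0" y "g z"]
    by (simp add: dist_commute[of y] algebra_simps)
  then show thesis
    using g n that by force
qed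

section \<open>Content and essential content of open sets\<close>

text \<open>
  The heart of the argument. For each \<open>y\<close> in \<open>\<Omega> \<inter> measure_support \<mu>\<close> choose a small copy \<open>g y ` cball 0 R\<close> of ratio
  \<open>c y\<close> inside \<open>\<Omega>\<close>, and use the Vitali covering lemma to select countably many, indexed by
  \<open>w \<in> W\<close>, for which the balls \<open>cball (g w 0) (2 * R * c w)\<close> are disjoint, while their fivefold
  enlargements cover. Let a cover of \<open>E\<close> by balls of radii \<open>t i\<close> be given. If one of the balls that
  meet the copy \<open>w\<close> is large compared to \<open>c w\<close>, then a dilation of it swallows the enlarged ball of
  \<open>w\<close>. Otherwise, all balls meeting the copy are centred in the Vitali ball of \<open>w\<close>, so that different
  such \<open>w\<close> use different balls; rescaling by \<open>g w\<close> turns these balls into a cover of a set of full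
  measure, so they satisfy \<open>\<Sum> t i powr s \<ge> const * c w powr s\<close> and pay for the enlarged ball
  of \<open>w\<close>. The factor \<open>q\<close> compares the Euclidean norm, for which the maps are similarities, with the sup norm.
\<close>

lemma hausdorff_content_le_cover:
  fixes \<mu> :: "(real ^ 'd) measure" and \<Omega> E :: "(real ^ 'd) set" and R \<eta> s :: real
  defines "q \<equiv> sqrt (real DIM(real ^ 'd))"
  assumes \<mu>: "self_similar_measure m f p \<mu>" and R: "0 < R" "emeasure \<mu> (cball 0 R) = 1"
    and s: "0 \<le> s" and \<eta>: "0 < \<eta>"
    and lower: "\<And>(I :: nat set) V \<rho>. (\<And>i. i \<in> I \<Longrightarrow> V i \<in> sets borel) \<Longrightarrow>
       (\<And>i. i \<in> I \<Longrightarrow> 0 < \<rho> i) \<Longrightarrow>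
       (\<And>i y z. i \<in> I \<Longrightarrow> y \<in> V i \<Longrightarrow> z \<in> V i \<Longrightarrow> infnorm (z - y) \<le> \<rho> i) \<Longrightarrow>
       (AE y in \<mu>. y \<in> (\<Union>i\<in>I. V i)) \<Longrightarrow>
       ennreal \<eta> \<le> (\<Sum>\<^sub>\<infinity>i\<in>I. ennreal (\<rho> i powr s))"
    and \<Omega>: "open \<Omega>" and E: "E \<in> sets borel" "E \<subseteq> \<Omega>" "emeasure \<mu> E = emeasure \<mu> \<Omega>"
    and cover: "\<And>i. i \<in> I \<Longrightarrow> 0 < t i" "E \<subseteq> (\<Union>i\<in>I. sup_cball (x i) (t i))"
  shows "hausdorff_content s (\<Omega> \<inter> measure_support \<mu>)
    \<le> ennreal ((24 * q) powr s + (40 * R * q) powr s / \<eta>)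
       * (\<Sum>\<^sub>\<infinity>i\<in>(I :: nat set). diameter_pow s (sup_cball (x i) (t i)))"
proof -
  have sets: "sets \<mu> = sets borel" and space: "space \<mu> = UNIV" and prob: "prob_space \<mu>"
    using \<mu> sets_eq_imp_space_eq[of \<mu> borel] by (auto simp: self_similar_measure_def)
  interpret prob_space \<mu> by fact
  have q: "0 < q"
    by (simp add: q_def)
  have norm_le: "norm v \<le> q * infnorm v" for v :: "real ^ 'd"
    unfolding q_def by (rule norm_le_infnorm)
  let ?K = "\<Omega> \<inter> measure_support \<mu>"
  have "\<exists>g c. null_preserving_similarity \<mu> c g \<and> c \<le> 1 \<and> dist (g 0) y \<le> 2 * R * c \<and>
      g ` cball 0 R \<subseteq> \<Omega>" if y: "y \<in> ?K" for y
  proof -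
    obtain d where d: "0 < d" "ball y d \<subseteq> \<Omega>"
      using \<Omega> y by (auto simp: open_contains_ball)
    have "0 < min 1 (d / (3 * R))"
      using d R by simp
    then obtain g c where g: "null_preserving_similarity \<mu> c g" "c < min 1 (d / (3 * R))"
      "dist (g 0) y \<le> 2 * R * c"
      using self_similar_small_copies[OF \<mu> R(2,1)] y by blast
    have "g z \<in> ball y d" if "z \<in> cball 0 R" for z
    proof -
      have "dist (g 0) (g z) = c * norm z" "0 < c"
        using g(1) by (auto simp: null_preserving_similarity_def)
      then have "dist (g 0) (g z) \<le> c * R"
        using that by (simp add: mult_left_mono)
      moreover have "3 * R * c < d"
        using g(2) R by (simp add: field_simps)
      ultimately show ?thesis
        using g(3) dist_triangle[of y "g z" "g 0"] by (simp add: dist_commute algebra_simps)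
    qed
    then show ?thesis
      using g d(2) by (intro exI[of _ g] exI[of _ c]) auto
  qed
  then obtain g c where g: "\<And>y. y \<in> ?K \<Longrightarrow> null_preserving_similarity \<mu> (c y) (g y)"
    and c1: "\<And>y. y \<in> ?K \<Longrightarrow> c y \<le> 1"
    and near: "\<And>y. y \<in> ?K \<Longrightarrow> dist (g y 0) y \<le> 2 * R * c y"
    and sub: "\<And>y. y \<in> ?K \<Longrightarrow> g y ` cball 0 R \<subseteq> \<Omega>"
    by metis
  have c: "0 < c y" and dist: "dist (g y u) (g y v) = c y * dist u v" if "y \<in> ?K" for y u v
    using g[OF that] by (auto simp: null_preserving_similarity_def)
  have "?K \<subseteq> (\<Union>y\<in>?K. cball (g y 0) (2 * R * c y))"
    using near by force
  moreover have "0 < 2 * R * c y \<and> 2 * R * c y \<le> 2 * R" if "y \<in> ?K" for y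
    using c[OF that] c1[OF that] R by simp
  ultimately obtain W where W: "countable W" "W \<subseteq> ?K"
    "pairwise (\<lambda>y z. disjnt (cball (g y 0) (2 * R * c y)) (cball (g z 0) (2 * R * c z))) W"
    "?K \<subseteq> (\<Union>y\<in>W. cball (g y 0) (5 * (2 * R * c y)))"
    by (rule Vitali_covering_lemma_cballs)
  have cW: "0 < c w" if "w \<in> W" for w
    using that W(2) c by blast
  \<comment> \<open>the balls of the cover that meet the copy \<open>w\<close>\<close>
  define N where "N w = {i \<in> I. sup_cball (x i) (t i) \<inter> g w ` cball 0 R \<noteq> {}}" for w
  have N: "dist (x i) (g w 0) \<le> q * t i + R * c w" if w: "w \<in> W" and i: "i \<in> N w" for w i
  proof -
    obtain z where z: "norm z \<le> R" "g w z \<in> sup_cball (x i) (t i)"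
      using i by (auto simp: N_def)
    have "dist (x i) (g w z) \<le> q * infnorm (g w z - x i)"
      using norm_le[of "g w z - x i"] by (simp add: dist_norm norm_minus_commute)
    also have "\<dots> \<le> q * t i"
      using z(2) q by (simp add: mem_sup_cball)
    finally have "dist (x i) (g w z) \<le> q * t i" .
    moreover have "dist (g w z) (g w 0) \<le> R * c w"
    proof -
      have "w \<in> ?K"
        using w W(2) by blast
      then show ?thesis
        using dist[of w z 0] c[of w] z(1) by (simp add: mult.commute mult_left_mono)
    qed
    ultimately show ?thesis
      using dist_triangle[of "x i" "g w 0" "g w z"] by linarith
  qed
  have scaled: "ennreal (\<eta> * (c w / (2 * q)) powr s) \<le> (\<Sum>\<^sub>\<infinity>i\<in>N w. ennreal (t i powr s))"
    if "w \<in> W" for w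
  proof -
    have w: "w \<in> ?K"
      using that W by auto
    let ?V = "\<lambda>i. g w -` sup_cball (x i) (t i) \<inter> cball 0 R"
    have "ennreal \<eta> \<le> (\<Sum>\<^sub>\<infinity>i\<in>N w. ennreal ((2 * q * t i / c w) powr s))"
    proof (rule lower[of _ ?V])
      fix i assume i: "i \<in> N w"
      then show "0 < 2 * q * t i / c w"
        using q cover(1)[of i] c[OF w] by (simp add: N_def)
      show "?V i \<in> sets borel"
        using borel_vimage_similarity[OF dist[OF w] sets_sup_cball] by (intro sets.Int) simp_all
      fix y z assume yz: "y \<in> ?V i" "z \<in> ?V i"
      have "c w * infnorm (z - y) \<le> c w * dist z y"
        using c[OF w] infnorm_le_norm[of "z - y"] by (simp add: dist_norm)
      also have "\<dots> = dist (g w z) (g w y)"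
        by (simp add: dist[OF w])
      also have "\<dots> \<le> q * infnorm (g w z - g w y)"
        using norm_le by (simp add: dist_norm)
      also have "\<dots> \<le> q * (2 * t i)"
        using yz infnorm_triangle_dist[of "g w z" "g w y" "x i"] q
        by (intro mult_left_mono) (auto simp: mem_sup_cball infnorm_sub[of "x i"])
      finally show "infnorm (z - y) \<le> 2 * q * t i / c w"
        using c[OF w] by (simp add: field_simps)
    next
      \<comment> \<open>Up to null sets, \<open>g w\<close> maps the ball of radius \<open>R\<close>, which has full measure, into \<open>E\<close>.\<close>
      have "emeasure \<mu> (\<Omega> - E) = 0"
        using E \<Omega> by (subst emeasure_Diff) (auto simp: sets)
      then have "emeasure \<mu> (g w -` (\<Omega> - E)) = 0"
        using g[OF w] E \<Omega> by (auto simp: null_preserving_similarity_def)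
      moreover have "g w -` (\<Omega> - E) \<in> sets borel"
        using E \<Omega> by (intro borel_vimage_similarity[OF dist[OF w]]) auto
      ultimately have "AE y in \<mu>. y \<notin> g w -` (\<Omega> - E)"
        by (intro AE_not_in null_setsI) (simp_all add: sets)
      moreover have "AE y in \<mu>. y \<in> cball 0 R"
        using R(2) prob_eq_1[of "cball 0 R"] by (simp add: sets emeasure_eq_measure)
      ultimately show "AE y in \<mu>. y \<in> (\<Union>i\<in>N w. ?V i)"
      proof eventually_elim
        case (elim y)
        have "g w y \<in> \<Omega>"
          using sub[OF w] elim(2) by blast
        then have "g w y \<in> E"
          using elim(1) by simp
        then obtain i where "i \<in> I" "g w y \<in> sup_cball (x i) (t i)"
          using cover(2) by auto
        moreover from this have "i \<in> N w"
          unfolding N_def using elim(2) by blast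
        ultimately show ?case
          using elim(2) by blast
      qed
    qed
    also have "\<dots> \<le> ennreal ((2 * q / c w) powr s) * (\<Sum>\<^sub>\<infinity>i\<in>N w. ennreal (t i powr s))"
    proof (rule infsum_ennreal_cmult_le)
      fix i assume "i \<in> N w"
      then have "0 < t i"
        using cover(1) by (simp add: N_def)
      then have "(2 * q * t i / c w) powr s = (2 * q / c w) powr s * t i powr s"
        using q c[OF w] powr_mult[of "2 * q / c w" "t i" s] by simp
      then show "ennreal ((2 * q * t i / c w) powr s)
          \<le> ennreal ((2 * q / c w) powr s) * ennreal (t i powr s)"
        by (simp add: ennreal_mult)
    qed
    finally have *: "ennreal \<eta>
        \<le> ennreal ((2 * q / c w) powr s) * (\<Sum>\<^sub>\<infinity>i\<in>N w. ennreal (t i powr s))" .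
    have "(c w / (2 * q)) powr s * (2 * q / c w) powr s = 1"
      using q c[OF w] by (simp flip: powr_mult)
    then have inv: "ennreal ((c w / (2 * q)) powr s) * ennreal ((2 * q / c w) powr s) = 1"
      by (simp flip: ennreal_mult)
    have "ennreal (\<eta> * (c w / (2 * q)) powr s) = ennreal ((c w / (2 * q)) powr s) * ennreal \<eta>"
      using \<eta> by (simp add: ennreal_mult mult.commute)
    also have "\<dots> \<le> ennreal ((c w / (2 * q)) powr s)
        * (ennreal ((2 * q / c w) powr s) * (\<Sum>\<^sub>\<infinity>i\<in>N w. ennreal (t i powr s)))"
      by (intro mult_left_mono *) simp
    also have "\<dots> = (\<Sum>\<^sub>\<infinity>i\<in>N w. ennreal (t i powr s))"
      by (simp add: mult.assoc[symmetric] inv)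
    finally show ?thesis .
  qed
  \<comment> \<open>the copies that meet only comparatively small balls of the cover\<close>
  define S where "S = {w \<in> W. \<forall>i\<in>N w. q * t i \<le> R * c w}"
  have disj: "disjoint_family_on N S"
    unfolding disjoint_family_on_def
  proof (intro ballI impI)
    fix v w assume vw: "v \<in> S" "w \<in> S" "v \<noteq> w"
    then have "disjnt (cball (g v 0) (2 * R * c v)) (cball (g w 0) (2 * R * c w))"
      using W(3) by (auto simp: S_def pairwise_def)
    moreover have "x i \<in> cball (g u 0) (2 * R * c u)" if "u \<in> S" "i \<in> N u" for u i
      using N[of u i] that by (auto simp: S_def dist_commute dest!: bspec)
    ultimately show "N v \<inter> N w = {}"
      using vw unfolding disjnt_def by blast
  qed
  let ?y = "\<lambda>j. case j of Inl i \<Rightarrow> x i | Inr w \<Rightarrow> g w 0"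
  let ?r = "\<lambda>j. case j of Inl i \<Rightarrow> 12 * q * t i | Inr w \<Rightarrow> 10 * R * c w"
  have "hausdorff_content s ?K
      \<le> (\<Sum>\<^sub>\<infinity>j\<in>I <+> S. diameter_pow s (sup_cball (?y j) (?r j)))"
  proof (rule hausdorff_content_le)
    have "S \<subseteq> W"
      by (auto simp: S_def)
    then show "countable (I <+> S)"
      using W(1) countable_subset by (auto intro!: countable_Plus)
    show "0 < ?r j" if "j \<in> I <+> S" for j
      using that q R(1) cover(1) cW by (auto simp: S_def)
    show "?K \<subseteq> (\<Union>j\<in>I <+> S. sup_cball (?y j) (?r j))"
    proof
      fix y assume "y \<in> ?K"
      then obtain w where w: "w \<in> W" "dist (g w 0) y \<le> 10 * R * c w"
        using W(4) by auto
      show "y \<in> (\<Union>j\<in>I <+> S. sup_cball (?y j) (?r j))"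
      proof (cases "w \<in> S")
        case True
        have "infnorm (y - g w 0) \<le> 10 * R * c w"
          using w(2) infnorm_le_norm[of "y - g w 0"] by (simp add: dist_norm norm_minus_commute)
        with True show ?thesis
          by (intro UN_I[of "Inr w"]) (auto simp: mem_sup_cball)
      next
        case False
        then obtain i where i: "i \<in> N w" "R * c w < q * t i"
          using w(1) by (auto simp: S_def not_le)
        have "dist (x i) y \<le> 12 * q * t i"
          using N[OF w(1) i(1)] w(2) i(2) dist_triangle[of "x i" y "g w 0"] by linarith
        then have "infnorm (y - x i) \<le> 12 * q * t i"
          using infnorm_le_norm[of "y - x i"] by (simp add: dist_norm norm_minus_commute)
        then show ?thesis
          using i(1) by (intro UN_I[of "Inl i"]) (auto simp: mem_sup_cball N_def)
      qed
    qed
  qed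
  also have "\<dots> = (\<Sum>\<^sub>\<infinity>i\<in>I. diameter_pow s (sup_cball (x i) (12 * q * t i)))
      + (\<Sum>\<^sub>\<infinity>w\<in>S. diameter_pow s (sup_cball (g w 0) (10 * R * c w)))"
    by (simp add: infsum_ennreal_Plus o_def)
  also have "\<dots> \<le> ennreal ((24 * q) powr s) * (\<Sum>\<^sub>\<infinity>i\<in>I. ennreal (t i powr s))
      + ennreal ((40 * R * q) powr s / \<eta>) * (\<Sum>\<^sub>\<infinity>w\<in>S. ennreal (\<eta> * (c w / (2 * q)) powr s))"
  proof (intro add_mono infsum_ennreal_cmult_le)
    fix i assume "i \<in> I"
    then have "0 < t i"
      by (rule cover(1))
    then have "diameter_pow s (sup_cball (x i) (12 * q * t i))
        \<le> ennreal ((2 * (12 * q * t i)) powr s)"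
      using q s by (intro diameter_pow_sup_cball_le) auto
    also have "(2 * (12 * q * t i)) powr s = (24 * q) powr s * t i powr s"
      using q \<open>0 < t i\<close> powr_mult[of "24 * q" "t i" s] by (simp add: mult_ac)
    finally show "diameter_pow s (sup_cball (x i) (12 * q * t i))
        \<le> ennreal ((24 * q) powr s) * ennreal (t i powr s)"
      by (simp add: ennreal_mult)
  next
    fix w assume "w \<in> S"
    then have cw: "0 < c w"
      using cW by (simp add: S_def)
    have "diameter_pow s (sup_cball (g w 0) (10 * R * c w))
        \<le> ennreal ((2 * (10 * R * c w)) powr s)"
      using R s cw by (intro diameter_pow_sup_cball_le) auto
    also have "2 * (10 * R * c w) = (40 * R * q) * (c w / (2 * q))"
      using q by (simp add: field_simps)
    also have "\<dots> powr s = (40 * R * q) powr s / \<eta> * (\<eta> * (c w / (2 * q)) powr s)"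
      using q R cw \<eta> powr_mult[of "40 * R * q" "c w / (2 * q)" s] by simp
    also have "ennreal \<dots>
        = ennreal ((40 * R * q) powr s / \<eta>) * ennreal (\<eta> * (c w / (2 * q)) powr s)"
      using \<eta> by (intro ennreal_mult) auto
    finally show "diameter_pow s (sup_cball (g w 0) (10 * R * c w))
        \<le> ennreal ((40 * R * q) powr s / \<eta>) * ennreal (\<eta> * (c w / (2 * q)) powr s)" .
  qed
  also have "\<dots> \<le> ennreal ((24 * q) powr s) * (\<Sum>\<^sub>\<infinity>i\<in>I. ennreal (t i powr s))
      + ennreal ((40 * R * q) powr s / \<eta>) * (\<Sum>\<^sub>\<infinity>i\<in>I. ennreal (t i powr s))"
  proof (intro add_left_mono mult_left_mono infsum_ennreal_disjoint_le[OF disj])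
    fix w assume "w \<in> S"
    then show "N w \<subseteq> I" "ennreal (\<eta> * (c w / (2 * q)) powr s)
        \<le> (\<Sum>\<^sub>\<infinity>i\<in>N w. ennreal (t i powr s))"
      using scaled by (auto simp: N_def S_def)
  qed simp
  also have "ennreal ((24 * q) powr s) * (\<Sum>\<^sub>\<infinity>i\<in>I. ennreal (t i powr s))
      + ennreal ((40 * R * q) powr s / \<eta>) * (\<Sum>\<^sub>\<infinity>i\<in>I. ennreal (t i powr s))
      = ennreal ((24 * q) powr s + (40 * R * q) powr s / \<eta>)
        * (\<Sum>\<^sub>\<infinity>i\<in>I. ennreal (t i powr s))"
    using \<eta> by (simp add: ennreal_plus distrib_right)
  also have "\<dots> \<le> ennreal ((24 * q) powr s + (40 * R * q) powr s / \<eta>)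
        * (\<Sum>\<^sub>\<infinity>i\<in>I. diameter_pow s (sup_cball (x i) (t i)))"
    using cover(1) s
    by (intro mult_left_mono infsum_ennreal_mono powr_radius_le_diameter_pow) auto
  finally show ?thesis .
qed

text \<open>
  For \<open>s\<close> below the dimension, removing a null set from an open set reduces the \<open>s\<close>-dimensional
  content of its trace on the support by at most a constant factor.
\<close>

theorem hausdorff_content_le_essential_content:
  fixes \<mu> :: "(real ^ 'd) measure"
  assumes "self_similar_measure m f p \<mu>" "has_exact_dimension \<mu> D" "0 \<le> s" "s < D"
  obtains C :: real where "0 < C"
    "\<And>\<Omega>. open \<Omega> \<Longrightarrow>
       hausdorff_content s (\<Omega> \<inter> measure_support \<mu>) \<le> ennreal C * essential_content \<mu> s \<Omega>"
proof -
  have sets: "sets \<mu> = sets borel" and prob: "prob_space \<mu>"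
    using assms(1) by (auto simp: self_similar_measure_def)
  obtain R where R: "0 < R" "emeasure \<mu> (cball 0 R) = 1"
    using self_similar_bounded[OF assms(1)] by blast
  obtain \<eta> :: real where \<eta>: "0 < \<eta>" and
    lower: "\<And>(I :: nat set) V \<rho>. (\<And>i. i \<in> I \<Longrightarrow> V i \<in> sets borel) \<Longrightarrow>
       (\<And>i. i \<in> I \<Longrightarrow> 0 < \<rho> i) \<Longrightarrow>
       (\<And>i y z. i \<in> I \<Longrightarrow> y \<in> V i \<Longrightarrow> z \<in> V i \<Longrightarrow> infnorm (z - y) \<le> \<rho> i) \<Longrightarrow>
       (AE y in \<mu>. y \<in> (\<Union>i\<in>I. V i)) \<Longrightarrow>
       ennreal \<eta> \<le> (\<Sum>\<^sub>\<infinity>i\<in>I. ennreal (\<rho> i powr s))"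
    using full_measure_cover_lower_bound[OF assms(2,4,3) prob sets] by blast
  define C where "C = (24 * sqrt (real DIM(real ^ 'd))) powr s
    + (40 * R * sqrt (real DIM(real ^ 'd))) powr s / \<eta>"
  have C: "0 < C"
    using R \<eta> by (simp add: C_def add_pos_pos)
  show thesis
  proof (rule that[OF C])
    fix \<Omega> :: "(real ^ 'd) set" assume \<Omega>: "open \<Omega>"
    show "hausdorff_content s (\<Omega> \<inter> measure_support \<mu>) \<le> ennreal C * essential_content \<mu> s \<Omega>"
      unfolding essential_content_def
    proof (rule mult_Inf_ennreal_ge)
      fix u assume "u \<in> {hausdorff_content s E | E.
        E \<in> sets borel \<and> E \<subseteq> \<Omega> \<and> emeasure \<mu> E = emeasure \<mu> \<Omega>}"
      then obtain E where E: "E \<in> sets borel" "E \<subseteq> \<Omega>" "emeasure \<mu> E = emeasure \<mu> \<Omega>"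
        and u: "u = hausdorff_content s E"
        by blast
      show "hausdorff_content s (\<Omega> \<inter> measure_support \<mu>) \<le> ennreal C * u"
        unfolding u hausdorff_content_def[of s E]
      proof (rule mult_Inf_ennreal_ge)
        fix v assume "v \<in> {(\<Sum>\<^sub>\<infinity>i\<in>I. diameter_pow s (sup_cball (x i) (r i))) | (I :: nat set) x r.
            (\<forall>i\<in>I. 0 < r i) \<and> E \<subseteq> (\<Union>i\<in>I. sup_cball (x i) (r i))}"
        then obtain I :: "nat set" and x r where I: "\<And>i. i \<in> I \<Longrightarrow> 0 < r i"
          "E \<subseteq> (\<Union>i\<in>I. sup_cball (x i) (r i))"
          and v: "v = (\<Sum>\<^sub>\<infinity>i\<in>I. diameter_pow s (sup_cball (x i) (r i)))"
          by blast
        show "hausdorff_content s (\<Omega> \<inter> measure_support \<mu>) \<le> ennreal C * v"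
          unfolding v C_def
          by (rule hausdorff_content_le_cover[OF assms(1) R assms(3) \<eta> lower \<Omega> E I])
      qed (use C in auto)
    qed (use C in auto)
  qed
qed

section \<open>Summation over dyadic scales\<close>

lemma weakly_redundant_measure_sum:
  fixes x :: "nat \<Rightarrow> real ^ 'd"
  assumes "weakly_redundant x r" "prob_space \<mu>" "sets \<mu> = sets borel"
  obtains J :: "nat \<Rightarrow> nat" where "\<And>k. 1 \<le> J k" "(\<lambda>k. log 2 (real (J k)) / real k) \<longlonglongrightarrow> 0"
    "\<And>k. (\<Sum>\<^sub>\<infinity>n\<in>dyadic_family r k. emeasure \<mu> (sup_cball (x n) (r n))) \<le> ennreal (real (J k))"
proof -
  interpret prob_space \<mu> by fact
  obtain J :: "nat \<Rightarrow> nat" where J: "\<And>k. 1 \<le> J k"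
    "(\<lambda>k. log 2 (real (J k)) / real k) \<longlonglongrightarrow> 0"
    and ex: "\<And>k. \<exists>P. (\<Union>j\<in>{1..J k}. P j) = dyadic_family r k \<and>
      disjoint_family_on P {1..J k} \<and>
      (\<forall>j\<in>{1..J k}. disjoint_family_on (\<lambda>n. sup_cball (x n) (r n)) (P j))"
    using assms(1) unfolding weakly_redundant_def by blast
  have "(\<Sum>\<^sub>\<infinity>n\<in>dyadic_family r k. emeasure \<mu> (sup_cball (x n) (r n))) \<le> ennreal (real (J k))"
    for k
  proof -
    obtain P where P: "(\<Union>j\<in>{1..J k}. P j) = dyadic_family r k"
      "\<And>j. j \<in> {1..J k} \<Longrightarrow> disjoint_family_on (\<lambda>n. sup_cball (x n) (r n)) (P j)"
      using ex[of k] by blast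
    have "\<forall>n\<in>dyadic_family r k. \<exists>j. j \<in> {1..J k} \<and> n \<in> P j"
      using P(1) by blast
    from bchoice[OF this] obtain h
      where h: "\<And>n. n \<in> dyadic_family r k \<Longrightarrow> h n \<in> {1..J k} \<and> n \<in> P (h n)"
      by blast
    have "(\<Sum>\<^sub>\<infinity>n\<in>dyadic_family r k. emeasure \<mu> (sup_cball (x n) (r n)))
        \<le> (\<Sum>\<^sub>\<infinity>j\<in>{1..J k}. 1)"
    proof (rule infsum_ennreal_group_le[where h = h])
      show "h ` dyadic_family r k \<subseteq> {1..J k}"
        using h by blast
      fix j assume j: "j \<in> {1..J k}"
      show "(\<Sum>\<^sub>\<infinity>n\<in>{n \<in> dyadic_family r k. h n = j}. emeasure \<mu> (sup_cball (x n) (r n))) \<le> 1"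
      proof (rule infsum_ennreal_le)
        fix F assume F: "finite F" "F \<subseteq> {n \<in> dyadic_family r k. h n = j}"
        then have "disjoint_family_on (\<lambda>n. sup_cball (x n) (r n)) F"
          using h by (intro disjoint_family_on_mono[OF _ P(2)[OF j]]) auto
        then have "(\<Sum>n\<in>F. emeasure \<mu> (sup_cball (x n) (r n)))
            = emeasure \<mu> (\<Union>n\<in>F. sup_cball (x n) (r n))"
          using F by (intro sum_emeasure) (auto simp: assms(3) sets_sup_cball)
        then show "(\<Sum>n\<in>F. emeasure \<mu> (sup_cball (x n) (r n))) \<le> 1"
          by (simp add: emeasure_le_1)
      qed
    qed
    also have "\<dots> = ennreal (real (J k))"
      by (simp add: ennreal_of_nat_eq_real_of_nat)
    finally show ?thesis .
  qed
  with J show thesis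
    by (rule that)
qed

lemma infsum_geometric_tail_le:
  fixes A q :: real
  assumes "0 \<le> A" "0 \<le> q" "q < 1"
  shows "(\<Sum>\<^sub>\<infinity>k\<in>{l..}. ennreal (A * q ^ k)) \<le> ennreal (A * q ^ l / (1 - q))"
proof (rule infsum_ennreal_le)
  fix F assume F: "finite F" "F \<subseteq> {l..}"
  obtain b where b: "\<And>k. k \<in> F \<Longrightarrow> k < b"
    using F(1) finite_nat_set_iff_bounded[of F] by auto
  have "(1 - q) * (\<Sum>k=l..<l + n. q ^ k) = q ^ l - q ^ (l + n)" for n
  proof (induction n)
    case (Suc n)
    have "(\<Sum>k=l..<l + Suc n. q ^ k) = (\<Sum>k=l..<l + n. q ^ k) + q ^ (l + n)"
      by simp
    then have "(1 - q) * (\<Sum>k=l..<l + Suc n. q ^ k)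
        = (q ^ l - q ^ (l + n)) + (1 - q) * q ^ (l + n)"
      by (simp only: distrib_left Suc.IH)
    also have "\<dots> = q ^ l - q ^ (l + Suc n)"
      by (simp add: left_diff_distrib)
    finally show ?case .
  qed simp
  from this[of b] have "(\<Sum>k=l..<l + b. q ^ k) * (1 - q) \<le> q ^ l"
    using assms by (simp add: mult.commute)
  then have *: "(\<Sum>k=l..<l + b. q ^ k) \<le> q ^ l / (1 - q)"
    using assms by (simp add: pos_le_divide_eq)
  have "F \<subseteq> {l..<l + b}"
  proof
    fix k assume "k \<in> F"
    then show "k \<in> {l..<l + b}"
      using F(2) b[of k] by auto
  qed
  then have "(\<Sum>k\<in>F. A * q ^ k) \<le> (\<Sum>k=l..<l + b. A * q ^ k)"
    using assms by (intro sum_mono2) auto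
  also have "\<dots> = A * (\<Sum>k=l..<l + b. q ^ k)"
    by (simp add: sum_distrib_left)
  also have "\<dots> \<le> A * (q ^ l / (1 - q))"
    using * assms by (intro mult_left_mono) auto
  finally have "(\<Sum>k\<in>F. A * q ^ k) \<le> A * q ^ l / (1 - q)"
    by simp
  moreover have "(\<Sum>k\<in>F. ennreal (A * q ^ k)) = ennreal (\<Sum>k\<in>F. A * q ^ k)"
    using assms by (intro sum_ennreal) auto
  ultimately show "(\<Sum>k\<in>F. ennreal (A * q ^ k)) \<le> ennreal (A * q ^ l / (1 - q))"
    by (simp add: ennreal_leI)
qed

lemma ex_dyadic_family:
  assumes "0 < r n" "r n \<le> (1/2) ^ l"
  obtains k where "l \<le> k" "n \<in> dyadic_family r k"
proof -
  \<comment> \<open>the scale of \<open>r n\<close>\<close>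
  define k where "k = (LEAST k. (1/2) ^ (k + 1) < r n)"
  obtain j where "(1/2) ^ j < r n"
    using real_arch_pow_inv[OF assms(1), of "1/2"] by auto
  moreover have "(1/2 :: real) ^ (j + 1) \<le> (1/2) ^ j"
    by (intro power_decreasing) auto
  ultimately have "(1/2) ^ (j + 1) < r n"
    by linarith
  then have lower: "(1/2) ^ (k + 1) < r n"
    unfolding k_def by (rule LeastI)
  have "l \<le> k"
  proof (rule ccontr)
    assume "\<not> l \<le> k"
    then have "(1/2 :: real) ^ l \<le> (1/2) ^ (k + 1)"
      by (intro power_decreasing) auto
    then show False
      using lower assms(2) by linarith
  qed
  have "r n \<le> (1/2) ^ k"
  proof (cases k)
    case 0
    have "(1/2 :: real) ^ l \<le> 1"
      by (simp add: power_le_one)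
    then show ?thesis
      using 0 assms(2) by simp
  next
    case (Suc i)
    then have "\<not> (1/2) ^ (i + 1) < r n"
      unfolding k_def by (intro not_less_Least) simp
    then show ?thesis
      using Suc by simp
  qed
  with lower \<open>l \<le> k\<close> show thesis
    by (intro that) (auto simp: dyadic_family_def)
qed

theorem theorem2p6:
  fixes m :: nat
    and f :: "nat \<Rightarrow> real ^ 'd \<Rightarrow> real ^ 'd"
    and p :: "nat \<Rightarrow> real"
    and \<mu> :: "(real ^ 'd) measure"
    and D s :: real
    and x :: "nat \<Rightarrow> real ^ 'd"
    and r :: "nat \<Rightarrow> real"
    and U :: "nat \<Rightarrow> (real ^ 'd) set"
  assumes "self_similar_measure m f p \<mu>"
    and "has_exact_dimension \<mu> D"
    and "\<And>n. 0 < r n"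
    and "weakly_redundant x r"
    and "(\<lambda>n. sup_diameter (sup_cball (x n) (r n))) \<longlonglongrightarrow> 0"
    and "\<And>n. open (U n)"
    and "\<And>n. U n \<subseteq> sup_cball (x n) (r n)"
    and "0 \<le> s" and "s < D"
    and "\<forall>\<^sub>F n in sequentially. essential_content \<mu> s (U n) \<le> emeasure \<mu> (sup_cball (x n) (r n))"
  shows "hausdorff_dim ((\<Inter>g. \<Union>n\<in>{g..}. U n) \<inter> measure_support \<mu>) \<le> ennreal s"
proof (rule hausdorff_dim_leI)
  have sets: "sets \<mu> = sets borel" and prob: "prob_space \<mu>"
    using assms(1) by (auto simp: self_similar_measure_def)
  interpret prob_space \<mu> by fact
  let ?B = "\<lambda>n. sup_cball (x n) (r n)"
  let ?L = "(\<Inter>g. \<Union>n\<in>{g..}. U n) \<inter> measure_support \<mu>"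
  obtain C :: real where C: "0 < C" and content: "\<And>\<Omega>. open \<Omega> \<Longrightarrow>
       hausdorff_content s (\<Omega> \<inter> measure_support \<mu>) \<le> ennreal C * essential_content \<mu> s \<Omega>"
    using hausdorff_content_le_essential_content[OF assms(1,2,8,9)] by blast
  obtain J :: "nat \<Rightarrow> nat" where J: "\<And>k. 1 \<le> J k" "(\<lambda>k. log 2 (real (J k)) / real k) \<longlonglongrightarrow> 0"
    "\<And>k. (\<Sum>\<^sub>\<infinity>n\<in>dyadic_family r k. emeasure \<mu> (?B n)) \<le> ennreal (real (J k))"
    using weakly_redundant_measure_sum[OF assms(4) prob sets] by blast
  have r0: "r \<longlonglongrightarrow> 0"
  proof (rule tendsto_sandwich[OF _ _ tendsto_const assms(5)])
    show "\<forall>\<^sub>F n in sequentially. r n \<le> sup_diameter (?B n)"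
      by (intro always_eventually allI radius_le_sup_diameter_sup_cball less_imp_le assms(3))
  qed (simp add: assms(3) less_imp_le)
  fix t \<delta> :: real assume t: "s < t" and \<delta>: "0 < \<delta>"
  define \<theta> where "\<theta> = t - s"
  have \<theta>: "0 < \<theta>"
    using t by (simp add: \<theta>_def)
  define c where "c = 2 * 2 powr s * C"
  have c: "0 < c"
    using C by (simp add: c_def)
  define q where "q = 2 powr (- \<theta> / 2)"
  have q: "0 < q" "q < 1"
    using \<theta> by (auto simp: q_def powr_less_one)
  define A where "A = c * 2 powr \<theta>"
  have A: "0 < A"
    using c by (simp add: A_def)
  \<comment> \<open>The factor 2 in \<open>c\<close> makes this inequality strict.\<close>
  have small: "hausdorff_premeasure \<delta> t (U n \<inter> measure_support \<mu>)
      < ennreal (c * (2 * r n) powr \<theta>) * emeasure \<mu> (?B n)"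
    if n: "U n \<inter> measure_support \<mu> \<noteq> {}" "2 * r n \<le> \<delta>"
      "essential_content \<mu> s (U n) \<le> emeasure \<mu> (?B n)" for n
  proof -
    obtain y where "y \<in> U n" "y \<in> measure_support \<mu>"
      using n(1) by auto
    then have "0 < emeasure \<mu> (U n)"
      using assms(6)[of n] by (simp add: measure_support_def)
    also have "\<dots> \<le> emeasure \<mu> (?B n)"
      using assms(7)[of n] by (intro emeasure_mono) (auto simp: sets sets_sup_cball)
    finally have pos: "0 < measure \<mu> (?B n)"
      by (simp add: emeasure_eq_measure)
    let ?b = "(2 * r n) powr \<theta> * 2 powr s"
    have "hausdorff_premeasure \<delta> t (U n \<inter> measure_support \<mu>)
        \<le> ennreal ?b * hausdorff_content s (U n \<inter> measure_support \<mu>)"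
      unfolding \<theta>_def using assms(3,7,8) n(2) t
      by (intro hausdorff_premeasure_le_content[of _ "x n"]) auto
    also have "\<dots> \<le> ennreal ?b * (ennreal C * essential_content \<mu> s (U n))"
      by (intro mult_left_mono content assms(6)) simp
    also have "\<dots> \<le> ennreal ?b * (ennreal C * emeasure \<mu> (?B n))"
      by (intro mult_left_mono n(3)) simp_all
    also have "\<dots> = ennreal (?b * (C * measure \<mu> (?B n)))"
      using C by (simp add: emeasure_eq_measure ennreal_mult)
    also have "\<dots> < ennreal (2 * (?b * (C * measure \<mu> (?B n))))"
      using C pos assms(3)[of n] by (intro ennreal_lessI) auto
    also have "2 * (?b * (C * measure \<mu> (?B n))) = c * (2 * r n) powr \<theta> * measure \<mu> (?B n)"
      by (simp add: c_def)
    also have "ennreal \<dots> = ennreal (c * (2 * r n) powr \<theta>) * emeasure \<mu> (?B n)"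
      using c by (simp add: emeasure_eq_measure ennreal_mult)
    finally show ?thesis .
  qed
  \<comment> \<open>Weak redundancy costs half of the exponent \<open>\<theta>\<close> gained from the radii.\<close>
  have J_le: "\<forall>\<^sub>F k in sequentially. real (J k) \<le> 2 powr (\<theta> / 2 * real k)"
    using order_tendstoD(2)[OF J(2) half_gt_zero[OF \<theta>]] eventually_gt_at_top[of 0]
  proof eventually_elim
    case (elim k)
    then have "log 2 (real (J k)) \<le> \<theta> / 2 * real k"
      by (simp add: field_simps)
    then show ?case
      using J(1)[of k] log_le_iff[of 2 "real (J k)" "\<theta> / 2 * real k"] by simp
  qed
  then obtain K where K: "\<And>k. K \<le> k \<Longrightarrow> real (J k) \<le> 2 powr (\<theta> / 2 * real k)"
    by (auto simp: eventually_sequentially)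
  have bound: "hausdorff_premeasure \<delta> t ?L \<le> ennreal (A * q ^ l / (1 - q))" if l: "K \<le> l" for l
  proof -
    have "\<forall>\<^sub>F n in sequentially. r n < (1/2) ^ l" "\<forall>\<^sub>F n in sequentially. r n < \<delta> / 2"
      using \<delta> by (intro order_tendstoD(2)[OF r0]; simp)+
    with assms(10) have "\<forall>\<^sub>F n in sequentially. r n \<le> (1/2) ^ l \<and> 2 * r n \<le> \<delta> \<and>
        essential_content \<mu> s (U n) \<le> emeasure \<mu> (?B n)"
      by eventually_elim auto
    then obtain g where g: "\<And>n. g \<le> n \<Longrightarrow> r n \<le> (1/2) ^ l \<and> 2 * r n \<le> \<delta> \<and>
        essential_content \<mu> s (U n) \<le> emeasure \<mu> (?B n)"
      by (auto simp: eventually_sequentially)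
    define N where "N = {n. g \<le> n \<and> U n \<inter> measure_support \<mu> \<noteq> {}}"
    have "\<forall>n\<in>N. \<exists>k. l \<le> k \<and> n \<in> dyadic_family r k"
    proof
      fix n assume "n \<in> N"
      then have "r n \<le> (1/2) ^ l"
        using g by (simp add: N_def)
      then show "\<exists>k. l \<le> k \<and> n \<in> dyadic_family r k"
        using ex_dyadic_family[of r n l] assms(3) by blast
    qed
    from bchoice[OF this] obtain h
      where h: "\<And>n. n \<in> N \<Longrightarrow> l \<le> h n \<and> n \<in> dyadic_family r (h n)"
      by blast
    have "?L \<subseteq> (\<Union>n\<in>N. U n \<inter> measure_support \<mu>)"
    proof
      fix y assume "y \<in> ?L"
      then have "y \<in> (\<Union>n\<in>{g..}. U n)" and y: "y \<in> measure_support \<mu>"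
        by (auto simp only: Int_iff INT_iff)
      then obtain n where "g \<le> n" "y \<in> U n"
        by auto
      with y show "y \<in> (\<Union>n\<in>N. U n \<inter> measure_support \<mu>)"
        unfolding N_def by blast
    qed
    then have "hausdorff_premeasure \<delta> t ?L
        \<le> hausdorff_premeasure \<delta> t (\<Union>n\<in>N. U n \<inter> measure_support \<mu>)"
      by (rule hausdorff_premeasure_mono)
    also have "\<dots> \<le> (\<Sum>\<^sub>\<infinity>n\<in>N. ennreal (c * (2 * r n) powr \<theta>) * emeasure \<mu> (?B n))"
      using g by (intro hausdorff_premeasure_UN_le small) (auto simp: N_def)
    also have "\<dots> \<le> (\<Sum>\<^sub>\<infinity>k\<in>{l..}. ennreal (A * q ^ k))"
    proof (rule infsum_ennreal_group_le[where h = h])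
      show "h ` N \<subseteq> {l..}"
        using h by auto
      fix k assume k: "k \<in> {l..}"
      let ?w = "A * 2 powr (- \<theta> * real k)"
      have "(\<Sum>\<^sub>\<infinity>n\<in>{n \<in> N. h n = k}. ennreal (c * (2 * r n) powr \<theta>) * emeasure \<mu> (?B n))
          \<le> ennreal ?w * (\<Sum>\<^sub>\<infinity>n\<in>{n \<in> N. h n = k}. emeasure \<mu> (?B n))"
      proof (intro infsum_ennreal_cmult_le mult_right_mono ennreal_leI)
        fix n assume "n \<in> {n \<in> N. h n = k}"
        then have "r n \<le> (1/2) ^ k"
          using h[of n] by (auto simp: dyadic_family_def)
        also have "\<dots> = 2 powr (- real k)"
          by (simp add: powr_minus_divide powr_realpow power_one_over)
        finally have "(2 * r n) powr \<theta> \<le> (2 * 2 powr (- real k)) powr \<theta>"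
          using assms(3)[of n] \<theta> by (intro powr_mono2) auto
        also have "\<dots> = 2 powr \<theta> * 2 powr (- \<theta> * real k)"
          using powr_mult[of 2 "2 powr (- real k)" \<theta>] powr_powr[of 2 "- real k" \<theta>]
          by (simp add: mult.commute)
        finally show "c * (2 * r n) powr \<theta> \<le> ?w"
          using c by (simp add: A_def mult.assoc)
      qed simp
      also have "\<dots> \<le> ennreal ?w * (\<Sum>\<^sub>\<infinity>n\<in>dyadic_family r k. emeasure \<mu> (?B n))"
        using h by (intro mult_left_mono infsum_mono_neutral) auto
      also have "\<dots> \<le> ennreal ?w * ennreal (real (J k))"
        by (intro mult_left_mono J(3)) simp
      also have "\<dots> = ennreal (?w * real (J k))"
        using A by (simp add: ennreal_mult)
      also have "\<dots> \<le> ennreal (A * q ^ k)"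
      proof (rule ennreal_leI)
        have "?w * real (J k) \<le> ?w * 2 powr (\<theta> / 2 * real k)"
          using K[of k] k l A by (intro mult_left_mono) auto
        also have "\<dots> = A * 2 powr (- \<theta> / 2 * real k)"
          by (simp add: mult.assoc flip: powr_add)
        also have "\<dots> = A * q ^ k"
          by (simp add: q_def powr_powr flip: powr_realpow)
        finally show "?w * real (J k) \<le> A * q ^ k" .
      qed
      finally show "(\<Sum>\<^sub>\<infinity>n\<in>{n \<in> N. h n = k}. ennreal (c * (2 * r n) powr \<theta>) * emeasure \<mu> (?B n))
          \<le> ennreal (A * q ^ k)" .
    qed
    also have "\<dots> \<le> ennreal (A * q ^ l / (1 - q))"
      using A q by (intro infsum_geometric_tail_le) auto
    finally show ?thesis .
  qed
  have "(\<lambda>l. ennreal (A * q ^ l / (1 - q))) \<longlonglongrightarrow> ennreal (A * 0 / (1 - q))"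
    using q by (intro tendsto_intros LIMSEQ_realpow_zero) auto
  then have "hausdorff_premeasure \<delta> t ?L \<le> ennreal (A * 0 / (1 - q))"
  proof (rule tendsto_lowerbound)
    show "\<forall>\<^sub>F l in sequentially. hausdorff_premeasure \<delta> t ?L \<le> ennreal (A * q ^ l / (1 - q))"
      using eventually_ge_at_top[of K] by eventually_elim (rule bound)
  qed simp
  then show "hausdorff_premeasure \<delta> t ?L = 0"
    by simp
qed (rule assms(8))

end
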